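(* Let $\mathbf{P}$ be a $(K,F,Z,S)$ SPDA. Then the scheme built from $\mathbf{P}$ (described in the context) is a $(K,M,N)$ coded caching scheme with memory ratio $\frac{M}{N}=\frac{F+Z}{2F}$, transmission rate $R=\frac{S}{F}$ and subpacketization $F$: every user can recover its requested file. Moreover, when all the requested files are different from each other, the scheme satisfies private demands for any user, i.e. for every $k\in[0,K)$, $$I\big(\mathbf{d}_{-k};\{X_{\mathcal{U}_s}: s\in[0,S),\ k\in\mathcal{U}_s\}\,\big|\,\phi_{d_k},\mathcal{Z}_k,d_k,\mathfrak{U}_k\big)=0 .$$
   Context: For a positive integer $n$, $[0,n)=\{0,1,\dots,n-1\}$. SPDA. For positive integers $K,F$, an $F\times K$ array $\mathbf{P}=(p_{j,k})_{j\in[0,F),k\in[0,K)}$ with entries in $\{*\}\cup[0,S)$ is a $(K,F,Z,S)$ secure placement delivery array (SPDA) if: (C1) the symbol $*$ appears exactly $Z$ times in each column; (C2) each $s\in[0,S)$ appears at least four times; (C3) for each $s\in[0,S)$, the subarray $\mathbf{P}^{(s)}$ formed by all rows and columns containing $s$ is, up to row and column permutations, a $(g+1)\times g$ array (for some $g$ depending on $s$) whose first row has all entries equal to $s$ and whose remaining $g$ rows form the $g\times g$ array with $s$ on the diagonal and $*$ off the diagonal. For each $s$, let $\mathcal{U}_s$ be the set of columns containing $s$ and let $j^{(s)}$ be the unique row containing $s$ at least twice. Caching system. A server holds $N$ files $W_0,\dots,W_{N-1}$, independent and uniform on $\{0,1\}^B$ (with $F\mid B$), and serves $K$ users $[0,K)$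 over a shared link; each user has a cache for file content of $MB$ bits (the cache space used by keys is not counted). User $k$ requests file $W_{d_k}$; $\mathbf{d}=(d_0,\dots,d_{K-1})\in[0,N)^K$ is random and independent of everything else, and $\mathbf{d}_{-k}$ is $\mathbf{d}$ with $d_k$ removed. "All requested files are different" means that $\mathbf{d}$ is uniformly distributed on vectors with pairwise distinct entries (so $N\ge K$). The scheme built from an SPDA $\mathbf{P}$. Placement: the server draws independent uniformly random permutations $\phi_0,\dots,\phi_{N-1}$ of $[0,F)$, known only to itself. Each file $W_n$ is split into $F$ consecutive packets of $B/F$ bits, and the packet in position $j$ carries the public label $\phi_n(j)$; the packet together with its label is written $W_{n,\phi_n(j)}$. Users see labels only, not positions. User $k$ caches the (labelled) packets $$\mathcal{Z}_k=\{W_{n,\phi_n(j)}: p_{j,k}=*,\ j\in[0,F),\ n\in[0,N)\}\cup\{W_{n,\phi_n(j^{(s)})}: p_{j^{(s)},k}=s,\ s\in[0,S),\ n\in[0,N)\}.$$ It also caches the secret keys $\mathcal{T}_k=\{T_{\mathcal{U}_s}: k\in\mathcal{U}_s\}$, where the keys $T_{\mathcal{U}_s}$ (one for each $s\in[0,S)$) are independent and uniform on $\{0,1\}^{B/F}$. Write $\mathfrak{U}_k=\{\mathcal{U}_s: s\in[0,S),\ k\in\mathcal{U}_s\}$. Delivery: given $\mathbf{d}$, for each $s\in[0,S)$ the server broadcasts $T_{\mathcal{U}_s}\oplus X_{\mathcal{U}_s}$, where $$X_{\mathcal{U}_s}=\Big(\bigoplus_{\substack{k\in\mathcal{U}_s,\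 j\in[0,F)\setminus\{j^{(s)}\}\\ p_{j,k}=s}}W_{d_k,\phi_{d_k}(j)}\Big)\oplus\Big(\bigoplus_{n\in[0,N)\setminus\{d_k:\,k\in\mathcal{U}_s\}}W_{n,\phi_n(j^{(s)})}\Big).$$ The signal has a header of negligible length giving the group $\mathcal{U}_s$ and the file indices and labels of the packets occurring in $X_{\mathcal{U}_s}$; in information quantities $X_{\mathcal{U}_s}$ is understood together with this header. The server also sends $\phi_{d_k}$ privately to user $k$ (negligible length). User $k$ can recover its file if $H\big(W_{d_k}\,\big|\,\mathcal{Z}_k,\mathcal{T}_k,\{T_{\mathcal{U}_s}\oplus X_{\mathcal{U}_s}: k\in\mathcal{U}_s\},\phi_{d_k}\big)=0$, headers being included. The rate $R$ is the total number of broadcast bits (excluding headers) divided by $B$; the subpacketization is the number of packets into which each file is split. $H$ and $I$ denote Shannon entropy and mutual information. *)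

theory Defs
  imports "HOL-Probability.Probability" "HOL-Library.Z2" "HOL-Combinatorics.Permutations"
begin

section \<open>Secure placement delivery arrays\<close>

text \<open>
  An \<open>F \<times> K\<close> array is a function \<open>P\<close> of the row \<open>j < F\<close> and the column \<open>k < K\<close>;
  \<^const>\<open>None\<close> is the symbol \<open>*\<close>. Values outside \<open>{..<F} \<times> {..<K}\<close> are irrelevant.
\<close>

type_synonym array = "nat \<Rightarrow> nat \<Rightarrow> nat option"

definition rows_of :: "nat \<Rightarrow> nat \<Rightarrow> array \<Rightarrow> nat \<Rightarrow> nat set" where
  "rows_of K F P s = {j. j < F \<and> (\<exists>k<K. P j k = Some s)}"

definition cols_of :: "nat \<Rightarrow> nat \<Rightarrow> array \<Rightarrow> nat \<Rightarrow> nat set" where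
  "cols_of K F P s = {k. k < K \<and> (\<exists>j<F. P j k = Some s)}"

text \<open>In the last clause \<open>r\<close> and \<open>c\<close> are the row and column permutations: row \<open>r 0\<close> is the
  constant row, the rows \<open>r 1, \<dots>, r g\<close> form the \<open>g \<times> g\<close> block.\<close>

definition spda :: "nat \<Rightarrow> nat \<Rightarrow> nat \<Rightarrow> nat \<Rightarrow> array \<Rightarrow> bool" where
  "spda K F Z S P \<longleftrightarrow>
     0 < K \<and> 0 < F \<and>
     (\<forall>j<F. \<forall>k<K. P j k \<in> {None} \<union> Some ` {..<S}) \<and>
     (\<forall>k<K. card {j. j < F \<and> P j k = None} = Z) \<and>
     (\<forall>s<S. 4 \<le> card {(j, k). j < F \<and> k < K \<and> P j k = Some s}) \<and>
     (\<forall>s<S. \<exists>g r c.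
        bij_betw r {..g} (rows_of K F P s) \<and> bij_betw c {..<g} (cols_of K F P s) \<and>
        (\<forall>b<g. P (r 0) (c b) = Some s) \<and>
        (\<forall>a<g. \<forall>b<g. P (r (Suc a)) (c b) = (if a = b then Some s else None)))"

definition main_row :: "nat \<Rightarrow> nat \<Rightarrow> array \<Rightarrow> nat \<Rightarrow> nat" where
  "main_row K F P s = (THE j. j < F \<and> 2 \<le> card {k. k < K \<and> P j k = Some s})"

text \<open>The indices of the transmissions that concern user \<open>k\<close>, and the groups it belongs to.\<close>

definition own :: "nat \<Rightarrow> nat \<Rightarrow> nat \<Rightarrow> array \<Rightarrow> nat \<Rightarrow> nat set" where
  "own K F S P k = {s. s < S \<and> k \<in> cols_of K F P s}"

definition groups :: "nat \<Rightarrow> nat \<Rightarrow> nat \<Rightarrow> array \<Rightarrow> nat \<Rightarrow> nat set set" where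
  "groups K F S P k = cols_of K F P ` own K F S P k"


section \<open>Files, packets, placement and delivery\<close>

text \<open>Bit strings are lists over \<^typ>\<open>bit\<close>, where \<open>+\<close> is exclusive or.\<close>

definition bitstrings :: "nat \<Rightarrow> bit list set" where
  "bitstrings L = {w. length w = L}"

definition xor :: "bit list \<Rightarrow> bit list \<Rightarrow> bit list" where
  "xor v w = map2 (+) v w"

definition Xor :: "nat \<Rightarrow> ('i \<Rightarrow> bit list) \<Rightarrow> 'i set \<Rightarrow> bit list" where
  "Xor L f A = map (\<lambda>i. \<Sum>x\<in>A. f x ! i) [0..<L]"

definition split_file :: "nat \<Rightarrow> bit list \<Rightarrow> bit list list" where
  "split_file F w =
     map (\<lambda>j. take (length w div F) (drop (j * (length w div F)) w)) [0..<F]"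

text \<open>
  Below, \<open>W\<close> are the files, \<open>\<phi>\<close> the permutations, \<open>T\<close> the keys (\<open>T s\<close> belongs to the group of
  \<open>s\<close>; different \<open>s\<close> may have the same group but still have different keys) and \<open>d\<close> the
  demands. The packet of file \<open>n\<close> in position \<open>j\<close> is stored as the triple of the file index
  \<open>n\<close>, the label \<open>\<phi> n j\<close> and the content; the position itself is not part of it.
\<close>

definition labelled_packet ::
    "nat \<Rightarrow> (nat \<Rightarrow> bit list) \<Rightarrow> (nat \<Rightarrow> nat \<Rightarrow> nat) \<Rightarrow> nat \<Rightarrow> nat \<Rightarrow> nat \<times> nat \<times> bit list" where
  "labelled_packet F W \<phi> n j = (n, \<phi> n j, split_file F (W n) ! j)"

definition cache ::
    "nat \<Rightarrow> nat \<Rightarrow> nat \<Rightarrow> nat \<Rightarrow> array \<Rightarrow> nat \<Rightarrow>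
     (nat \<Rightarrow> bit list) \<Rightarrow> (nat \<Rightarrow> nat \<Rightarrow> nat) \<Rightarrow> (nat \<times> nat \<times> bit list) set" where
  "cache K F S N P k W \<phi> =
     {labelled_packet F W \<phi> n j | n j. n < N \<and> j < F \<and> P j k = None} \<union>
     {labelled_packet F W \<phi> n (main_row K F P s) | n s.
        n < N \<and> s < S \<and> P (main_row K F P s) k = Some s}"

definition key_cache ::
    "nat \<Rightarrow> nat \<Rightarrow> nat \<Rightarrow> array \<Rightarrow> nat \<Rightarrow> (nat \<Rightarrow> bit list) \<Rightarrow> nat \<Rightarrow> bit list" where
  "key_cache K F S P k T = restrict T (own K F S P k)"

definition single_cells :: "nat \<Rightarrow> nat \<Rightarrow> array \<Rightarrow> nat \<Rightarrow> (nat \<times> nat) set" where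
  "single_cells K F P s =
     {(k, j). k \<in> cols_of K F P s \<and> j \<in> {..<F} - {main_row K F P s} \<and> P j k = Some s}"

definition filler_files :: "nat \<Rightarrow> nat \<Rightarrow> nat \<Rightarrow> array \<Rightarrow> (nat \<Rightarrow> nat) \<Rightarrow> nat \<Rightarrow> nat set" where
  "filler_files K F N P d s = {..<N} - d ` cols_of K F P s"

text \<open>The content of a signal, of \<open>L = B div F\<close> bits.\<close>

definition payload ::
    "nat \<Rightarrow> nat \<Rightarrow> nat \<Rightarrow> nat \<Rightarrow> array \<Rightarrow> (nat \<Rightarrow> bit list) \<Rightarrow> (nat \<Rightarrow> nat) \<Rightarrow> nat \<Rightarrow> bit list" where
  "payload K F N L P W d s =
     xor (Xor L (\<lambda>(k, j). split_file F (W (d k)) ! j) (single_cells K F P s))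
         (Xor L (\<lambda>n. split_file F (W n) ! main_row K F P s) (filler_files K F N P d s))"

text \<open>The header: the group, and the file indices and labels of the packets in the signal.\<close>

definition header ::
    "nat \<Rightarrow> nat \<Rightarrow> nat \<Rightarrow> array \<Rightarrow> (nat \<Rightarrow> nat \<Rightarrow> nat) \<Rightarrow> (nat \<Rightarrow> nat) \<Rightarrow> nat \<Rightarrow>
     nat set \<times> (nat \<times> nat) set" where
  "header K F N P \<phi> d s =
     (cols_of K F P s,
      (\<lambda>(k, j). (d k, \<phi> (d k) j)) ` single_cells K F P s \<union>
      (\<lambda>n. (n, \<phi> n (main_row K F P s))) ` filler_files K F N P d s)"

definition signal where
  "signal K F N L P W \<phi> d s = (header K F N P \<phi> d s, payload K F N L P W d s)"

definition broadcast where
  "broadcast K F N L P W \<phi> T d s =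
     (header K F N P \<phi> d s, xor (T s) (payload K F N L P W d s))"


section \<open>The probabilistic model\<close>

definition demand_vectors :: "nat \<Rightarrow> nat \<Rightarrow> (nat \<Rightarrow> nat) set" where
  "demand_vectors K N = {..<K} \<rightarrow>\<^sub>E {..<N}"

definition distinct_demands :: "nat \<Rightarrow> nat \<Rightarrow> (nat \<Rightarrow> nat) pmf" where
  "distinct_demands K N = pmf_of_set {d \<in> demand_vectors K N. inj_on d {..<K}}"

type_synonym outcome =
  "(nat \<Rightarrow> bit list) \<times> (nat \<Rightarrow> nat \<Rightarrow> nat) \<times> (nat \<Rightarrow> bit list) \<times> (nat \<Rightarrow> nat)"

text \<open>The joint law of files, permutations, keys and demands, where \<open>D\<close> is the law of the
  demands.\<close>

definition system_pmf :: "nat \<Rightarrow> nat \<Rightarrow> nat \<Rightarrow> nat \<Rightarrow> (nat \<Rightarrow> nat) pmf \<Rightarrow> outcome pmf" where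
  "system_pmf F S N B D =
     pair_pmf (Pi_pmf {..<N} [] (\<lambda>_. pmf_of_set (bitstrings B)))
    (pair_pmf (Pi_pmf {..<N} id (\<lambda>_. pmf_of_set {\<pi>. \<pi> permutes {..<F}}))
    (pair_pmf (Pi_pmf {..<S} [] (\<lambda>_. pmf_of_set (bitstrings (B div F))))
       D))"

text \<open>Restricting to the (finite) support makes all random variables simple functions, as the
  library's entropy and mutual information over \<^const>\<open>count_space\<close> of the range require.\<close>

definition system :: "nat \<Rightarrow> nat \<Rightarrow> nat \<Rightarrow> nat \<Rightarrow> (nat \<Rightarrow> nat) pmf \<Rightarrow> outcome measure" where
  "system F S N B D =
     restrict_space (measure_pmf (system_pmf F S N B D)) (set_pmf (system_pmf F S N B D))"

abbreviation cond_entropy :: "'a measure \<Rightarrow> ('a \<Rightarrow> 'b) \<Rightarrow> ('a \<Rightarrow> 'c) \<Rightarrow> real" where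
  "cond_entropy M X Y \<equiv>
     prob_space.conditional_entropy M 2 (count_space (X ` space M)) (count_space (Y ` space M)) X Y"

abbreviation cond_mutual_info ::
    "'a measure \<Rightarrow> ('a \<Rightarrow> 'b) \<Rightarrow> ('a \<Rightarrow> 'c) \<Rightarrow> ('a \<Rightarrow> 'd) \<Rightarrow> real" where
  "cond_mutual_info M X Y Z \<equiv>
     prob_space.conditional_mutual_information M 2
       (count_space (X ` space M)) (count_space (Y ` space M)) (count_space (Z ` space M)) X Y Z"


section \<open>Performance of the scheme\<close>

text \<open>The memory \<open>M\<close> used by user \<open>k\<close> for file content, and the rate, both in units of one file.\<close>

definition memory :: "nat \<Rightarrow> nat \<Rightarrow> nat \<Rightarrow> nat \<Rightarrow> nat \<Rightarrow> array \<Rightarrow> nat \<Rightarrow> outcome \<Rightarrow> real" where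
  "memory K F S N B P k = (\<lambda>(W, \<phi>, T, d).
     real (\<Sum>(n, l, w)\<in>cache K F S N P k W \<phi>. length w) / real B)"

definition rate :: "nat \<Rightarrow> nat \<Rightarrow> nat \<Rightarrow> nat \<Rightarrow> nat \<Rightarrow> array \<Rightarrow> outcome \<Rightarrow> real" where
  "rate K F S N B P = (\<lambda>(W, \<phi>, T, d).
     real (\<Sum>s<S. length (snd (broadcast K F N (B div F) P W \<phi> T d s))) / real B)"

text \<open>Every file is split into exactly \<open>q\<close> packets of \<open>B / q\<close> consecutive bits.\<close>

definition has_subpacketization :: "nat \<Rightarrow> nat \<Rightarrow> nat \<Rightarrow> nat \<Rightarrow> outcome \<Rightarrow> bool" where
  "has_subpacketization F N B q = (\<lambda>(W, \<phi>, T, d). \<forall>n<N.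
     concat (split_file F (W n)) = W n \<and>
     length (split_file F (W n)) = q \<and>
     (\<forall>w\<in>set (split_file F (W n)). real (length w) = real B / real q))"

definition requested_file :: "nat \<Rightarrow> outcome \<Rightarrow> bit list" where
  "requested_file k = (\<lambda>(W, \<phi>, T, d). W (d k))"

definition demand :: "nat \<Rightarrow> outcome \<Rightarrow> nat" where
  "demand k = (\<lambda>(W, \<phi>, T, d). d k)"

definition other_demands :: "nat \<Rightarrow> nat \<Rightarrow> outcome \<Rightarrow> nat \<Rightarrow> nat" where
  "other_demands K k = (\<lambda>(W, \<phi>, T, d). restrict d ({..<K} - {k}))"

text \<open>What user \<open>k\<close> decodes from.\<close>

definition decoder_input where
  "decoder_input K F S N B P k = (\<lambda>(W, \<phi>, T, d).
     (cache K F S N P k W \<phi>, key_cache K F S P k T,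
      restrict (broadcast K F N (B div F) P W \<phi> T d) (own K F S P k), \<phi> (d k)))"

definition own_signals where
  "own_signals K F S N B P k = (\<lambda>(W, \<phi>, T, d).
     restrict (signal K F N (B div F) P W \<phi> d) (own K F S P k))"

definition side_information where
  "side_information K F S N P k = (\<lambda>(W, \<phi>, T, d).
     (\<phi> (d k), cache K F S N P k W \<phi>, d k, groups K F S P k))"

end

theory Submission
  imports Defs
begin

text \<open>
  In column \<open>k\<close> every symbol \<open>s\<close> that occurs does so twice: once in its main row, whose packets user
  \<open>k\<close> caches, and once in another row. This gives the memory ratio, and it makes the packet of
  \<open>W\<^bsub>d k\<^esub>\<close> in that other row the only packet of the signal \<open>s\<close> which user \<open>k\<close> lacks.

  For privacy let the demands be distinct. Then the signal \<open>s\<close> contains exactly one packet of every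
  file \<open>n\<close>; for \<open>n \<noteq> d k\<close> it lies in a row that user \<open>k\<close> caches, and for fixed \<open>n\<close> these rows are
  different for different \<open>s\<close>. Hence the rows of the file \<open>n\<close> admit an involution which exchanges,
  for all \<open>s\<close> of user \<open>k\<close> at once, the main row of \<open>s\<close> with the row occurring in the signal. Applied
  to the positions of the packets it preserves the law of files and permutations and the cache of
  user \<open>k\<close>, and it turns the signals into ones that depend on the demands only through \<open>d k\<close>.
\<close>

section \<open>Information measures of finitely supported laws\<close>

text \<open>Passing to the support keeps every probability but makes all subsets measurable, so with
  finite support every function becomes a simple random variable.\<close>

lemma support_space:
  fixes p :: "'a pmf"
  defines "M \<equiv> restrict_space (measure_pmf p) (set_pmf p)"
  shows space_support_space: "space M = set_pmf p"
    and sets_support_space: "sets M = Pow (set_pmf p)"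
    and prob_space_support_space: "prob_space M"
    and measure_support_space: "measure M (A \<inter> set_pmf p) = measure_pmf.prob p A"
proof -
  show "space M = set_pmf p" by (simp add: M_def space_restrict_space)
  show "sets M = Pow (set_pmf p)" by (auto simp: M_def sets_restrict_space)
  show "prob_space M"
    unfolding M_def by (rule prob_space_restrict_space) (auto simp: measure_pmf.emeasure_eq_measure measure_pmf.prob_eq_1 AE_measure_pmf_iff)
  show "measure M (A \<inter> set_pmf p) = measure_pmf.prob p A"
    unfolding M_def by (subst measure_restrict_space) (auto simp: measure_Int_set_pmf)
qed

lemma simple_distributed_support_space:
  assumes "finite (set_pmf p)"
  shows "simple_distributed (restrict_space (measure_pmf p) (set_pmf p)) X
           (\<lambda>x. measure_pmf.prob p {a. X a = x})"
proof (rule prob_space.simple_distributedI[OF prob_space_support_space])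
  show "simple_function (restrict_space (measure_pmf p) (set_pmf p)) X"
    using assms by (auto simp: simple_function_def space_support_space sets_support_space)
  fix x
  have "X -` {x} \<inter> set_pmf p = {a. X a = x} \<inter> set_pmf p" by auto
  then show "measure_pmf.prob p {a. X a = x} =
      measure (restrict_space (measure_pmf p) (set_pmf p)) (X -` {x} \<inter> space (restrict_space (measure_pmf p) (set_pmf p)))"
    by (simp add: measure_support_space space_support_space)
qed simp

lemma information_space_support_space:
  "information_space (restrict_space (measure_pmf p) (set_pmf p)) 2"
proof -
  interpret prob_space "restrict_space (measure_pmf p) (set_pmf p)" by (rule prob_space_support_space)
  show ?thesis by unfold_locales simp
qed

text \<open>On the support \<open>X\<close> is a function of \<open>Y\<close>, so fixing the pair
  costs no more probability than fixing \<open>Y\<close> alone, and every logarithm in the entropy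
  sum is that of 1.\<close>

lemma cond_entropy_determined:
  assumes "finite (set_pmf p)"
    and "\<And>a b. a \<in> set_pmf p \<Longrightarrow> b \<in> set_pmf p \<Longrightarrow> Y a = Y b \<Longrightarrow> X a = X b"
  shows "cond_entropy (restrict_space (measure_pmf p) (set_pmf p)) X Y = 0"
proof -
  interpret information_space "restrict_space (measure_pmf p) (set_pmf p)" 2
    by (rule information_space_support_space)
  note sd = simple_distributed_support_space[OF assms(1)]
  have eq: "measure_pmf.prob p {b. (X b, Y b) = (X a, Y a)} = measure_pmf.prob p {b. Y b = Y a}"
    if "a \<in> set_pmf p" for a
    by (rule measure_pmf.finite_measure_eq_AE) (auto simp: AE_measure_pmf_iff intro: assms(2)[OF _ that])
  have "log 2 (measure_pmf.prob p {b. (X b, Y b) = (X a, Y a)} / measure_pmf.prob p {b. Y b = Y a}) = 0"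
    if "a \<in> set_pmf p" for a
    unfolding eq[OF that] using measure_pmf_posI[OF that, of "{b. Y b = Y a}"] by simp
  then show ?thesis
    unfolding conditional_entropy_eq[OF sd sd] neg_equal_0_iff_equal
    by (intro sum.neutral) (auto simp only: space_support_space prod.case mult_zero_right)
qed

text \<open>Conditional independence is stated in product form to avoid division. At a support point
  all the events have positive probability, so the quotient under the logarithm is 1.\<close>

lemma cond_mutual_info_zeroI:
  assumes "finite (set_pmf p)"
    and "\<And>a. a \<in> set_pmf p \<Longrightarrow>
      measure_pmf.prob p {b. X b = X a \<and> Y b = Y a \<and> Z b = Z a} * measure_pmf.prob p {b. Z b = Z a} =
      measure_pmf.prob p {b. X b = X a \<and> Z b = Z a} * measure_pmf.prob p {b. Y b = Y a \<and> Z b = Z a}"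
  shows "cond_mutual_info (restrict_space (measure_pmf p) (set_pmf p)) X Y Z = 0"
proof -
  interpret information_space "restrict_space (measure_pmf p) (set_pmf p)" 2
    by (rule information_space_support_space)
  note sd = simple_distributed_support_space[OF assms(1)]
  have pos: "measure_pmf.prob p E > 0" if "a \<in> set_pmf p" "a \<in> E" for a E
    using that by (meson measure_pmf_posI)
  have "log 2 (measure_pmf.prob p {b. (X b, Y b, Z b) = (X a, Y a, Z a)} /
      (measure_pmf.prob p {b. (X b, Z b) = (X a, Z a)} *
       (measure_pmf.prob p {b. (Y b, Z b) = (Y a, Z a)} / measure_pmf.prob p {b. Z b = Z a}))) = 0"
    if "a \<in> set_pmf p" for a
    using assms(2)[OF that] pos[OF that, of "{b. X b = X a \<and> Z b = Z a}"]
      pos[OF that, of "{b. Y b = Y a \<and> Z b = Z a}"] pos[OF that, of "{b. Z b = Z a}"]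
    by simp
  then show ?thesis
    unfolding conditional_mutual_information_eq[OF sd sd sd sd]
    by (intro sum.neutral) (auto simp only: space_support_space prod.case mult_zero_right)
qed

text \<open>The abstract privacy argument. Since \<open>\<theta> d\<close> preserves
  \<open>Q\<close>, replacing \<open>q\<close> by \<open>\<theta> d q\<close> does not change the
  joint law with \<open>d\<close>. After the replacement \<open>Y\<close> and \<open>Z\<close> see
  the demands only through \<open>h d\<close>, which \<open>Z\<close> already fixes, so the
  independent parts \<open>q\<close> and \<open>d\<close> factor.\<close>

lemma cond_mutual_info_zero_of_invariance:
  fixes g :: "'q \<times> 'd \<Rightarrow> 'a" and \<theta> :: "'d \<Rightarrow> 'q \<Rightarrow> 'q"
  assumes fin: "finite (set_pmf Q)" "finite (set_pmf D)"
    and inv: "\<And>d. d \<in> set_pmf D \<Longrightarrow> map_pmf (\<theta> d) Q = Q"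
    and X: "\<And>q d. q \<in> set_pmf Q \<Longrightarrow> d \<in> set_pmf D \<Longrightarrow> X (g (q, d)) = X' d"
    and Y: "\<And>q d. q \<in> set_pmf Q \<Longrightarrow> d \<in> set_pmf D \<Longrightarrow> Y (g (q, d)) = Y' (\<theta> d q) (h d)"
    and Z: "\<And>q d. q \<in> set_pmf Q \<Longrightarrow> d \<in> set_pmf D \<Longrightarrow> Z (g (q, d)) = Z' (\<theta> d q) (h d)"
    and h: "\<And>q q' d d'. Z' q (h d) = Z' q' (h d') \<Longrightarrow> h d = h d'"
  defines "p \<equiv> map_pmf g (pair_pmf Q D)"
  shows "cond_mutual_info (restrict_space (measure_pmf p) (set_pmf p)) X Y Z = 0"
proof (rule cond_mutual_info_zeroI)
  show "finite (set_pmf p)" using fin by (simp add: p_def)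
  fix a assume "a \<in> set_pmf p"
  then obtain q0 d0 where a: "a = g (q0, d0)" "q0 \<in> set_pmf Q" "d0 \<in> set_pmf D" by (auto simp: p_def)
  let ?P = "pair_pmf Q D"
  \<comment> \<open>Drawing \<open>d\<close> first reduces invariance of the joint law to invariance
    of \<open>Q\<close> for each fixed \<open>d\<close>.\<close>
  have "map_pmf (\<lambda>(q, d). (\<theta> d q, d)) ?P = bind_pmf D (\<lambda>d. map_pmf (\<lambda>q. (q, d)) (map_pmf (\<theta> d) Q))"
    by (subst pair_commute_pmf) (simp add: pair_pmf_def map_bind_pmf map_pmf_comp bind_return_pmf map_pmf_def bind_assoc_pmf)
  also have "\<dots> = bind_pmf D (\<lambda>d. map_pmf (\<lambda>q. (q, d)) Q)"
    by (rule bind_pmf_cong) (simp_all add: inv)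
  also have "\<dots> = ?P"
    by (subst pair_commute_pmf) (simp add: pair_pmf_def map_bind_pmf map_pmf_comp bind_return_pmf map_pmf_def bind_assoc_pmf)
  finally have P: "map_pmf (\<lambda>(q, d). (\<theta> d q, d)) ?P = ?P" .
  \<comment> \<open>Taking \<open>A\<close> and \<open>C\<close> to be either trivial or an equality
    with the value at \<open>a\<close> yields all four probabilities of the independence
    criterion.\<close>
  have factor: "measure_pmf.prob p {b. A (X b) \<and> C (Y b) \<and> Z b = Z a} =
      measure_pmf.prob Q {q. C (Y' q (h d0)) \<and> Z' q (h d0) = Z a} * measure_pmf.prob D {d. A (X' d) \<and> h d = h d0}"
    for A C
  proof -
    let ?E = "{q. C (Y' q (h d0)) \<and> Z' q (h d0) = Z a}" and ?G = "{d. A (X' d) \<and> h d = h d0}"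
    have hd: "h d = h d0" if "Z' q (h d) = Z a" for q d
      using that h Z[OF a(2,3)] unfolding a(1) by metis
    have "measure_pmf.prob p {b. A (X b) \<and> C (Y b) \<and> Z b = Z a} =
        measure_pmf.prob ?P {(q, d). A (X' d) \<and> C (Y' (\<theta> d q) (h d)) \<and> Z' (\<theta> d q) (h d) = Z a}"
      unfolding p_def measure_map_pmf
      by (rule measure_pmf.finite_measure_eq_AE) (simp_all add: AE_measure_pmf_iff X Y Z)
    also have "\<dots> = measure_pmf.prob (map_pmf (\<lambda>(q, d). (\<theta> d q, d)) ?P) 
        {(q, d). A (X' d) \<and> C (Y' q (h d)) \<and> Z' q (h d) = Z a}"
      unfolding measure_map_pmf by (rule arg_cong[where f="measure_pmf.prob ?P"]) auto
    also have "\<dots> = measure_pmf.prob ?P {(q, d). A (X' d) \<and> C (Y' q (h d)) \<and> Z' q (h d) = Z a}"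
      unfolding P ..
    \<comment> \<open>Because \<open>Z a\<close> determines \<open>h d0\<close>, the event is a
      rectangle.\<close>
    also have "{(q, d). A (X' d) \<and> C (Y' q (h d)) \<and> Z' q (h d) = Z a} = ?E \<times> ?G"
      by (rule set_eqI, clarsimp, rename_tac q d, case_tac "h d = h d0") (use hd in metis)+
    \<comment> \<open>Intersecting with the supports makes both sides of the rectangle countable, as
      the product rule demands.\<close>
    also have "measure_pmf.prob ?P (?E \<times> ?G) = measure_pmf.prob ?P ((?E \<inter> set_pmf Q) \<times> (?G \<inter> set_pmf D))"
      by (rule measure_pmf.finite_measure_eq_AE) (auto simp: AE_measure_pmf_iff)
    also have "\<dots> = measure_pmf.prob Q ?E * measure_pmf.prob D ?G"
      by (subst measure_pmf_prob_product) (simp_all add: measure_Int_set_pmf)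
    finally show ?thesis .
  qed
  show "measure_pmf.prob p {b. X b = X a \<and> Y b = Y a \<and> Z b = Z a} * measure_pmf.prob p {b. Z b = Z a} =
      measure_pmf.prob p {b. X b = X a \<and> Z b = Z a} * measure_pmf.prob p {b. Y b = Y a \<and> Z b = Z a}"
    using factor[of "\<lambda>x. x = X a" "\<lambda>y. y = Y a"] factor[of "\<lambda>x. True" "\<lambda>y. True"]
      factor[of "\<lambda>x. x = X a" "\<lambda>y. True"] factor[of "\<lambda>x. True" "\<lambda>y. y = Y a"]
    by simp
qed

section \<open>Packets and permutations\<close>

lemma length_concat_equal_blocks:
  assumes "\<And>v. v \<in> set vs \<Longrightarrow> length v = l"
  shows "length (concat vs) = length vs * l"
  using assms by (induction vs) auto

lemma nth_block_concat:
  assumes "\<And>v. v \<in> set vs \<Longrightarrow> length v = l" and "j < length vs"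
  shows "take l (drop (j * l) (concat vs)) = vs ! j"
  using assms
proof (induction vs arbitrary: j)
  case (Cons v vs)
  then show ?case by (cases j) auto
qed simp

lemma concat_blocks: "concat (map (\<lambda>j. take l (drop (j * l) w)) [0..<n]) = take (n * l) w"
  by (induction n) (simp_all add: take_add add.commute[of l])

lemma length_split_file: "length (split_file F w) = F"
  by (simp add: split_file_def)

lemma concat_split_file:
  assumes "F dvd length w"
  shows "concat (split_file F w) = w"
  using assms by (simp add: split_file_def concat_blocks)

lemma length_nth_split_file:
  assumes "j < F"
  shows "length (split_file F w ! j) = length w div F"
proof -
  have "Suc j * (length w div F) \<le> F * (length w div F)"
    using assms by (intro mult_le_mono1) simp
  also have "\<dots> \<le> length w" by simp
  finally show ?thesis using assms by (simp add: split_file_def)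
qed

lemma split_file_concat:
  assumes "\<And>v. v \<in> set vs \<Longrightarrow> length v = l" and "length vs = F"
  shows "split_file F (concat vs) = vs"
\<comment> \<open>For \<open>F = 0\<close> the block length cannot be recovered by division, but
  both sides are the empty list.\<close>
proof (cases "F = 0")
  case False
  then show ?thesis
    using assms by (intro nth_equalityI)
      (auto simp: split_file_def length_concat_equal_blocks nth_block_concat)
qed (use assms in \<open>simp add: split_file_def\<close>)

lemma length_Xor: "length (Xor l f A) = l"
  by (simp add: Xor_def)

text \<open>Injectivity and disjointness keep the summands apart: an index hit twice would cancel on
  the left but count once in the union.\<close>

lemma xor_Xor_union:
  assumes "inj_on f A" "inj_on g A'" "f ` A \<inter> g ` A' = {}" "finite A" "finite A'"
  shows "xor (Xor l (\<lambda>x. h (f x)) A) (Xor l (\<lambda>x. h (g x)) A') = Xor l h (f ` A \<union> g ` A')"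
  using assms
  by (intro nth_equalityI) (auto simp: xor_def Xor_def sum.union_disjoint sum.reindex)

lemma nth_xor: "i < length u \<Longrightarrow> i < length v \<Longrightarrow> xor u v ! i = u ! i + v ! i"
  by (simp add: xor_def)

lemma xor_left_cancel:
  assumes "length u = length v" "length u = length w" "xor u v = xor u w"
  shows "v = w"
proof (rule nth_equalityI)
  fix i assume "i < length v"
  then have "u ! i + v ! i = u ! i + w ! i"
    using assms by (metis nth_xor)
  then show "v ! i = w ! i"
    using add_left_imp_eq by blast
qed (use assms in simp)

text \<open>The action of a map of packet positions on the contents of a file; labels are acted on
  separately, by composition with the same map.\<close>

definition permute_file :: "nat \<Rightarrow> (nat \<Rightarrow> nat) \<Rightarrow> bit list \<Rightarrow> bit list" where
  "permute_file F \<sigma> w = concat (map (\<lambda>j. split_file F w ! \<sigma> j) [0..<F])"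

lemma split_permute_file:
  assumes "\<And>j. j < F \<Longrightarrow> \<sigma> j < F" "j < F"
  shows "split_file F (permute_file F \<sigma> w) ! j = split_file F w ! \<sigma> j"
  unfolding permute_file_def using assms
  by (subst split_file_concat[where l="length w div F"]) (auto simp: length_nth_split_file)

lemma permute_file_bitstrings:
  assumes "\<And>j. j < F \<Longrightarrow> \<sigma> j < F" "F dvd B" "w \<in> bitstrings B"
  shows "permute_file F \<sigma> w \<in> bitstrings B"
  unfolding permute_file_def bitstrings_def mem_Collect_eq using assms
  by (subst length_concat_equal_blocks[where l="B div F"]) (auto simp: length_nth_split_file bitstrings_def)

lemma permute_file_involution:
  assumes "\<And>j. j < F \<Longrightarrow> \<sigma> j < F" "\<And>j. j < F \<Longrightarrow> \<sigma> (\<sigma> j) = j" "F dvd length w"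
  shows "permute_file F \<sigma> (permute_file F \<sigma> w) = w"
proof -
  have "map (\<lambda>j. split_file F (permute_file F \<sigma> w) ! \<sigma> j) [0..<F] = split_file F w"
    using assms(1,2) by (intro nth_equalityI) (auto simp: split_permute_file length_split_file)
  then show ?thesis
    by (subst permute_file_def) (simp add: concat_split_file assms(3))
qed

text \<open>The simultaneous transposition of \<open>f a\<close> and \<open>g a\<close> for all
  \<open>a \<in> A\<close>, which makes sense when \<open>f\<close> and \<open>g\<close> are
  injective on \<open>A\<close> with disjoint images.\<close>

definition exchange :: "('i \<Rightarrow> 'a) \<Rightarrow> ('i \<Rightarrow> 'a) \<Rightarrow> 'i set \<Rightarrow> 'a \<Rightarrow> 'a" where
  "exchange f g A x =
     (if x \<in> f ` A then g (inv_into A f x) else if x \<in> g ` A then f (inv_into A g x) else x)"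

lemma exchange_left: "inj_on f A \<Longrightarrow> a \<in> A \<Longrightarrow> exchange f g A (f a) = g a"
  by (simp add: exchange_def)

lemma exchange_right:
  "inj_on g A \<Longrightarrow> f ` A \<inter> g ` A = {} \<Longrightarrow> a \<in> A \<Longrightarrow> exchange f g A (g a) = f a"
  by (auto simp: exchange_def)

lemma exchange_other: "x \<notin> f ` A \<union> g ` A \<Longrightarrow> exchange f g A x = x"
  by (auto simp: exchange_def)

lemma exchange_involution:
  assumes "inj_on f A" "inj_on g A" "f ` A \<inter> g ` A = {}"
  shows "exchange f g A (exchange f g A x) = x"
proof -
  consider a where "a \<in> A" "x = f a" | a where "a \<in> A" "x = g a" | "x \<notin> f ` A \<union> g ` A" by blast
  then show ?thesis
    by cases (simp_all add: exchange_left exchange_right exchange_other assms)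
qed

lemma exchange_mem:
  assumes "inj_on f A" "inj_on g A" "f ` A \<inter> g ` A = {}" "f ` A \<subseteq> C" "g ` A \<subseteq> C" "x \<in> C"
  shows "exchange f g A x \<in> C"
proof -
  consider a where "a \<in> A" "x = f a" | a where "a \<in> A" "x = g a" | "x \<notin> f ` A \<union> g ` A" by blast
  then show ?thesis using assms(4-6)
    by cases (auto simp: exchange_left exchange_right exchange_other assms(1-3))
qed

section \<open>Uniform laws under involutions, and the joint law of the system\<close>

lemma map_pmf_of_set_involution:
  assumes "finite A" "A \<noteq> {}" "\<And>x. x \<in> A \<Longrightarrow> f x \<in> A" "\<And>x. x \<in> A \<Longrightarrow> f (f x) = x"
  shows "map_pmf f (pmf_of_set A) = pmf_of_set A"
  by (rule map_pmf_of_set_bij_betw) (use assms in \<open>auto intro!: bij_betw_byWitness[where f'=f]\<close>)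

lemma finite_bitstrings: "finite (bitstrings L)"
proof -
  have UNIV: "(UNIV :: bit set) \<subseteq> {0, 1}"
    by (metis UNIV_I bit_not_zero_iff insertCI subsetI)
  show ?thesis
    using finite_lists_length_eq[OF finite_subset[OF UNIV], of L] by (simp add: bitstrings_def)
qed

lemma bitstrings_nonempty: "bitstrings L \<noteq> {}"
  by (auto simp: bitstrings_def intro: exI[of _ "replicate L 0"])

text \<open>The product of uniform laws is uniform on the dependent functions with the given
  default, and acting by an involution in each coordinate is an involution of that set.\<close>

lemma map_pmf_Pi_pmf_involution:
  assumes "finite A" "\<And>x. x \<in> A \<Longrightarrow> finite (C x)" "\<And>x. x \<in> A \<Longrightarrow> C x \<noteq> {}"
    and "\<And>x v. x \<in> A \<Longrightarrow> v \<in> C x \<Longrightarrow> f x v \<in> C x" "\<And>x v. x \<in> A \<Longrightarrow> v \<in> C x \<Longrightarrow> f x (f x v) = v"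
  shows "map_pmf (\<lambda>w x. if x \<in> A then f x (w x) else dflt) (Pi_pmf A dflt (\<lambda>x. pmf_of_set (C x))) =
    Pi_pmf A dflt (\<lambda>x. pmf_of_set (C x))"
proof -
  have ne: "PiE_dflt A dflt C \<noteq> {}"
    using assms(3) by (intro ex_in_conv[THEN iffD1] exI[of _ "\<lambda>x. if x \<in> A then SOME v. v \<in> C x else dflt"])
      (auto simp: PiE_dflt_def some_in_eq)
  have eq: "Pi_pmf A dflt (\<lambda>x. pmf_of_set (C x)) = pmf_of_set (PiE_dflt A dflt C)"
    by (rule Pi_pmf_of_set) (use assms in auto)
  have "finite (PiE_dflt A dflt C)" using assms(1,2) by blast
  then show ?thesis
    unfolding eq
    by (rule map_pmf_of_set_involution[OF _ ne])
      (use assms in \<open>auto simp: PiE_dflt_def fun_eq_iff\<close>)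
qed

text \<open>Separates the demands from the other components, the shape which the invariance
  criterion expects.\<close>

lemma system_pmf_eq:
  "system_pmf F S N B D = map_pmf (\<lambda>((W, \<phi>, T), d). (W, \<phi>, T, d))
    (pair_pmf (pair_pmf (Pi_pmf {..<N} [] (\<lambda>_. pmf_of_set (bitstrings B)))
      (pair_pmf (Pi_pmf {..<N} id (\<lambda>_. pmf_of_set {\<pi>. \<pi> permutes {..<F}}))
        (Pi_pmf {..<S} [] (\<lambda>_. pmf_of_set (bitstrings (B div F)))))) D)"
  by (simp add: system_pmf_def pair_pair_pmf pair_map_pmf2 map_pmf_comp case_prod_unfold)

lemma finite_demand_vectors: "finite (demand_vectors K N)"
  by (simp add: demand_vectors_def finite_PiE)

lemma set_Pi_pmf_of_set:
  assumes "finite A" "finite C" "C \<noteq> {}"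
  shows "set_pmf (Pi_pmf A dflt (\<lambda>_. pmf_of_set C)) = PiE_dflt A dflt (\<lambda>_. C)"
  using assms by (simp add: set_Pi_pmf comp_def)

lemma finite_label_permutations: "finite {\<pi>. \<pi> permutes {..<F::nat}}" "{\<pi>. \<pi> permutes {..<F::nat}} \<noteq> {}"
  by (auto intro: finite_permutations permutes_id)

lemmas set_pmf_components =
  set_Pi_pmf_of_set[OF finite_lessThan finite_bitstrings bitstrings_nonempty]
  set_Pi_pmf_of_set[OF finite_lessThan finite_label_permutations]

lemma finite_set_system_pmf:
  assumes "finite (set_pmf D)"
  shows "finite (set_pmf (system_pmf F S N B D))"
  using assms by (auto simp: system_pmf_def set_pmf_components finite_bitstrings finite_label_permutations
      intro!: finite_cartesian_product finite_PiE_dflt)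

section \<open>Structure of the array and of the signals\<close>

text \<open>Translates the block form of (C3) into facts about single entries that no longer mention
  the permutations \<open>r\<close> and \<open>c\<close>: each column of the group meets
  \<open>s\<close> once in the main row and once on the diagonal, with \<open>*\<close> elsewhere in
  the block.\<close>

lemma spda_block:
  assumes "spda K F Z S P" and "s < S"
  shows main_row_less: "main_row K F P s < F"
    and main_row_iff: "k < K \<Longrightarrow> P (main_row K F P s) k = Some s \<longleftrightarrow> k \<in> cols_of K F P s"
    and ex_single_row: "k \<in> cols_of K F P s \<Longrightarrow> \<exists>j<F. j \<noteq> main_row K F P s \<and> P j k = Some s"
    and single_row_unique: "k < K \<Longrightarrow> P j k = Some s \<Longrightarrow> P j' k = Some s \<Longrightarrow> j < F \<Longrightarrow> j' < F \<Longrightarrow>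
      j \<noteq> main_row K F P s \<Longrightarrow> j' \<noteq> main_row K F P s \<Longrightarrow> j' = j"
    and single_row_None: "k < K \<Longrightarrow> P j k = Some s \<Longrightarrow> j < F \<Longrightarrow> j \<noteq> main_row K F P s \<Longrightarrow>
      k' \<in> cols_of K F P s \<Longrightarrow> k' \<noteq> k \<Longrightarrow> P j k' = None"
proof -
  obtain g r c where r: "bij_betw r {..g} (rows_of K F P s)" and c: "bij_betw c {..<g} (cols_of K F P s)"
    and top: "\<And>b. b < g \<Longrightarrow> P (r 0) (c b) = Some s"
    and diag: "\<And>a b. a < g \<Longrightarrow> b < g \<Longrightarrow> P (r (Suc a)) (c b) = (if a = b then Some s else None)"
  proof -
    have "\<exists>g r c.
        bij_betw r {..g} (rows_of K F P s) \<and> bij_betw c {..<g} (cols_of K F P s) \<and>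
        (\<forall>b<g. P (r 0) (c b) = Some s) \<and>
        (\<forall>a<g. \<forall>b<g. P (r (Suc a)) (c b) = (if a = b then Some s else None))"
      using assms unfolding spda_def by blast
    then show ?thesis using that by blast
  qed
  have cell: "\<exists>b<g. k = c b \<and> (j = r 0 \<or> j = r (Suc b))" if jk: "j < F" "k < K" "P j k = Some s" for j k
  proof -
    have "j \<in> r ` {..g}" "k \<in> c ` {..<g}"
      using jk r c by (auto simp: bij_betw_def rows_of_def cols_of_def)
    then obtain a b where ab: "a \<le> g" "j = r a" "b < g" "k = c b" by auto
    show ?thesis
    proof (cases a)
      case (Suc a')
      then show ?thesis using ab diag[of a' b] jk(3) by (auto split: if_splits)
    qed (use ab in auto)
  qed
  have r_less: "r a < F" if "a \<le> g" for a
    using r that by (auto simp: bij_betw_def rows_of_def)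
  have c_less: "c b < K" if "b < g" for b
    using c that by (auto simp: bij_betw_def cols_of_def)
  have r_inj: "r a = r b \<longleftrightarrow> a = b" if "a \<le> g" "b \<le> g" for a b
    using r that by (auto simp: bij_betw_def inj_on_def)
  have c_inj: "c a = c b \<longleftrightarrow> a = b" if "a < g" "b < g" for a b
    using c that by (auto simp: bij_betw_def inj_on_def)
  \<comment> \<open>The block has only \<open>2 * g\<close> cells with \<open>s\<close>, so (C2)
    forces \<open>g\<close> to be at least 2; this distinguishes the constant row from the diagonal
    rows.\<close>
  have "4 \<le> card {(j, k). j < F \<and> k < K \<and> P j k = Some s}"
    using assms unfolding spda_def by blast
  also have "{(j, k). j < F \<and> k < K \<and> P j k = Some s} \<subseteq>
      (\<lambda>b. (r 0, c b)) ` {..<g} \<union> (\<lambda>b. (r (Suc b), c b)) ` {..<g}"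
    using cell by fastforce
  then have "card {(j, k). j < F \<and> k < K \<and> P j k = Some s} \<le>
      card ((\<lambda>b. (r 0, c b)) ` {..<g} \<union> (\<lambda>b. (r (Suc b), c b)) ` {..<g})"
    by (intro card_mono) auto
  also have "\<dots> \<le> g + g"
    by (rule order_trans[OF card_Un_le]) (intro add_mono card_image_le[THEN order_trans]; simp)
  finally have g: "2 \<le> g" by simp
  have c_surj: "\<exists>b<g. k = c b" if "k \<in> cols_of K F P s" for k
    using c that unfolding bij_betw_def by auto
  have top_eq: "{k. k < K \<and> P (r 0) k = Some s} = cols_of K F P s"
  proof
    show "cols_of K F P s \<subseteq> {k. k < K \<and> P (r 0) k = Some s}"
      using c_surj top c_less by fastforce
  qed (use r_less in \<open>auto simp: cols_of_def\<close>)
  \<comment> \<open>Row \<open>r 0\<close> carries \<open>s\<close> in all \<open>g\<close> columns,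
    any other row at most once.\<close>
  have "main_row K F P s = r 0"
    unfolding main_row_def
  proof (rule the_equality)
    show "r 0 < F \<and> 2 \<le> card {k. k < K \<and> P (r 0) k = Some s}"
      using top_eq bij_betw_same_card[OF c] g r_less by simp
    fix j assume j: "j < F \<and> 2 \<le> card {k. k < K \<and> P j k = Some s}"
    show "j = r 0"
    proof (rule ccontr)
      assume "j \<noteq> r 0"
      with j cell have row: "\<exists>b<g. k = c b \<and> j = r (Suc b)" if "k < K" "P j k = Some s" for k
        using that by blast
      have "k = k'" if "k < K" "P j k = Some s" "k' < K" "P j k' = Some s" for k k'
        using row[OF that(1,2)] row[OF that(3,4)] r_inj by (auto simp: less_eq_Suc_le)
      then have "card {k. k < K \<and> P j k = Some s} \<le> 1"
        by (subst card_le_Suc0_iff_eq[unfolded One_nat_def[symmetric]]) auto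
      with j show False by simp
    qed
  qed
  then have main: "main_row K F P s = r 0" .
  show "main_row K F P s < F" using main r_less by simp
  show "P (main_row K F P s) k = Some s \<longleftrightarrow> k \<in> cols_of K F P s" if "k < K"
    using top_eq that main by auto
  show "\<exists>j<F. j \<noteq> main_row K F P s \<and> P j k = Some s" if k: "k \<in> cols_of K F P s"
  proof -
    obtain b where "b < g" "k = c b" using c_surj[OF k] by blast
    then show ?thesis using diag[of b b] r_inj[of "Suc b" 0] r_less[of "Suc b"] main by auto
  qed
  show "j' = j" if "k < K" "P j k = Some s" "P j' k = Some s" "j < F" "j' < F"
      "j \<noteq> main_row K F P s" "j' \<noteq> main_row K F P s"
    using cell[OF that(4,1,2)] cell[OF that(5,1,3)] that(6,7) c_inj main by auto
  show "P j k' = None" if hyps: "k < K" "P j k = Some s" "j < F" "j \<noteq> main_row K F P s"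
      "k' \<in> cols_of K F P s" "k' \<noteq> k"
  proof -
    obtain b where b: "b < g" "k = c b" "j = r (Suc b)" using cell[OF hyps(3,1,2)] hyps(4) main by auto
    obtain b' where "b' < g" "k' = c b'" using c_surj[OF hyps(5)] by blast
    then show ?thesis using b hyps(6) diag[of b b'] by auto
  qed
qed

section \<open>The rows of one column: cached and missing packets\<close>

locale spda_scheme =
  fixes K F Z S N B :: nat and P :: array
  assumes spda: "spda K F Z S P" and B_pos: "0 < B" and F_dvd: "F dvd B"
begin

abbreviation main :: "nat \<Rightarrow> nat" where "main \<equiv> main_row K F P"
abbreviation cols :: "nat \<Rightarrow> nat set" where "cols \<equiv> cols_of K F P"
abbreviation signals :: "nat \<Rightarrow> nat set" where "signals \<equiv> own K F S P"

lemma F_pos: "0 < F"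
  using spda by (simp add: spda_def)

text \<open>The position of the packet that user \<open>k\<close> gains from transmission
  \<open>s\<close>, namely the diagonal row of column \<open>k\<close>; meaningful for
  \<open>s < S\<close> and \<open>k \<in> cols s\<close>.\<close>

definition single :: "nat \<Rightarrow> nat \<Rightarrow> nat" where
  "single s k = (THE j. j < F \<and> j \<noteq> main s \<and> P j k = Some s)"

lemma cols_less: "k \<in> cols s \<Longrightarrow> k < K"
  by (simp add: cols_of_def)

lemma finite_cols: "finite (cols s)"
  by (simp add: cols_of_def)

lemma single:
  assumes "s < S" "k \<in> cols s"
  shows "single s k < F" "single s k \<noteq> main s" "P (single s k) k = Some s"
proof -
  have "\<exists>!j. j < F \<and> j \<noteq> main s \<and> P j k = Some s"
    using ex_single_row[OF spda assms] single_row_unique[OF spda assms(1) cols_less[OF assms(2)]] by blast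
  from theI'[OF this, folded single_def]
  show "single s k < F" "single s k \<noteq> main s" "P (single s k) k = Some s" by auto
qed

lemma single_eqI:
  assumes "s < S" "k < K" "j < F" "j \<noteq> main s" "P j k = Some s"
  shows "j = single s k"
proof -
  have "k \<in> cols s" using assms by (auto simp: cols_of_def)
  from single[OF assms(1) this] show ?thesis
    using single_row_unique[OF spda assms(1,2)] assms(3-5) by blast
qed

lemma single_None: "s < S \<Longrightarrow> k \<in> cols s \<Longrightarrow> k' \<in> cols s \<Longrightarrow> k' \<noteq> k \<Longrightarrow> P (single s k) k' = None"
  using single_row_None[OF spda _ cols_less] single by blast

lemma main_eq: "s < S \<Longrightarrow> k \<in> cols s \<Longrightarrow> P (main s) k = Some s"
  using main_row_iff[OF spda _ cols_less] by blast

lemma main_less: "s < S \<Longrightarrow> main s < F"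
  by (rule main_row_less[OF spda])

lemma signals_iff: "s \<in> signals k \<longleftrightarrow> s < S \<and> k \<in> cols s"
  by (simp add: own_def)

lemma finite_signals: "finite (signals k)"
  by (simp add: own_def)

text \<open>The entry of column \<open>k\<close> in a row is one symbol, so the row determines
  \<open>s\<close>.\<close>

lemma inj_on_main: "inj_on main (signals k)"
  by (rule inj_onI) (metis main_eq signals_iff option.inject)

lemma inj_on_single: "inj_on (\<lambda>s. single s k) (signals k)"
  by (rule inj_onI) (metis single(3) signals_iff option.inject)

lemma main_neq_single: "s \<in> signals k \<Longrightarrow> s' \<in> signals k \<Longrightarrow> main s \<noteq> single s' k"
  by (metis main_eq single(2,3) signals_iff option.inject)

text \<open>Cached positions are the same for every file, so the cache is a product of file indices
  and these positions.\<close>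

definition cached :: "nat \<Rightarrow> nat set" where
  "cached k = {j. j < F \<and> P j k = None} \<union> main ` signals k"

lemma cached_less: "j \<in> cached k \<Longrightarrow> j < F"
  by (auto simp: cached_def signals_iff main_less)

lemma finite_cached: "finite (cached k)"
  by (rule finite_subset[of _ "{..<F}"]) (auto simp: cached_less)

lemma cache_eq:
  assumes "k < K"
  shows "cache K F S N P k W \<phi> = {labelled_packet F W \<phi> n j | n j. n < N \<and> j \<in> cached k}"
proof -
  have "s < S \<and> P (main s) k = Some s \<longleftrightarrow> s \<in> signals k" for s
    using main_row_iff[OF spda _ assms] by (auto simp: signals_iff)
  then show ?thesis unfolding cache_def cached_def by blast
qed

lemma array_entry: "j < F \<Longrightarrow> k < K \<Longrightarrow> P j k = Some s \<Longrightarrow> s < S"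
  using spda unfolding spda_def by fastforce

text \<open>A row of column \<open>k\<close> shows either \<open>*\<close> or a symbol of user
  \<open>k\<close>; in the second case it is the main row or the single row of that symbol, and only
  the latter is not cached.\<close>

lemma rows_partition:
  assumes "k < K"
  shows "{..<F} = cached k \<union> (\<lambda>s. single s k) ` signals k" "cached k \<inter> (\<lambda>s. single s k) ` signals k = {}"
proof -
  have "j \<in> cached k \<union> (\<lambda>s. single s k) ` signals k" if "j < F" for j
  proof (cases "P j k")
    case (Some s)
    then have "s \<in> signals k" using assms that array_entry by (auto simp: signals_iff cols_of_def)
    moreover from this have "j = main s \<or> j = single s k"
      using single_eqI[OF _ assms that] Some by (auto simp: signals_iff)
    ultimately show ?thesis by (auto simp: cached_def)
  qed (use that in \<open>simp add: cached_def\<close>)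
  then show "{..<F} = cached k \<union> (\<lambda>s. single s k) ` signals k"
    using cached_less single(1) by (auto simp: signals_iff)
  show "cached k \<inter> (\<lambda>s. single s k) ` signals k = {}"
    using main_neq_single single(3) by (fastforce simp: cached_def signals_iff)
qed

lemma card_rows:
  assumes "k < K"
  shows "F = card (cached k) + card (signals k)"
  using arg_cong[OF rows_partition(1)[OF assms], of card] rows_partition(2)[OF assms]
  by (subst (asm) card_Un_disjoint) (auto simp: finite_signals finite_cached card_image[OF inj_on_single])

text \<open>Each signal of user \<open>k\<close> accounts for one cached main row and one missing
  single row. Adding the two counts eliminates the number of signals.\<close>

lemma card_cached:
  assumes "k < K"
  shows "2 * card (cached k) = F + Z"
proof -
  have "card (cached k) = Z + card (signals k)"
  proof -
    have "card {j. j < F \<and> P j k = None} = Z" using assms spda by (simp add: spda_def)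
    moreover have "{j. j < F \<and> P j k = None} \<inter> main ` signals k = {}"
      using main_eq by (fastforce simp: signals_iff)
    ultimately show ?thesis
      unfolding cached_def by (subst card_Un_disjoint) (auto simp: finite_signals card_image[OF inj_on_main])
  qed
  with card_rows[OF assms] show ?thesis by simp
qed

section \<open>The packets of a signal, as pairs of file and position\<close>

definition cells :: "(nat \<Rightarrow> nat) \<Rightarrow> nat \<Rightarrow> (nat \<times> nat) set" where
  "cells d s = (\<lambda>(k, j). (d k, j)) ` single_cells K F P s \<union> (\<lambda>n. (n, main s)) ` filler_files K F N P d s"

lemma single_cells_eq: "s < S \<Longrightarrow> single_cells K F P s = (\<lambda>k. (k, single s k)) ` cols s"
  using single single_eqI[OF _ cols_less] by (fastforce simp: single_cells_def image_iff)

lemma finite_cells: "s < S \<Longrightarrow> finite (cells d s)"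
  by (simp add: cells_def single_cells_eq finite_cols filler_files_def)

lemma cells_eq:
  "s < S \<Longrightarrow> cells d s = (\<lambda>k. (d k, single s k)) ` cols s \<union> (\<lambda>n. (n, main s)) ` ({..<N} - d ` cols s)"
  by (simp add: cells_def single_cells_eq filler_files_def image_image)

lemma header_eq: "header K F N P \<phi> d s = (cols s, (\<lambda>(n, j). (n, \<phi> n j)) ` cells d s)"
  by (simp add: header_def cells_def image_Un image_image case_prod_unfold)

lemma payload_eq:
  assumes "s < S"
  shows "payload K F N l P W d s = Xor l (\<lambda>(n, j). split_file F (W n) ! j) (cells d s)"
proof -
  have "inj_on (\<lambda>(k, j). (d k, j)) (single_cells K F P s)"
    unfolding single_cells_eq[OF assms]
  proof (rule inj_onI, clarsimp)
    \<comment> \<open>Demands may coincide here, so the rows must separate the cells: the single row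
      of one column shows \<open>*\<close> in every other column of the group.\<close>
    fix k k' assume "k \<in> cols s" "k' \<in> cols s" "single s k = single s k'"
    then show "k = k'" using single_None[OF assms, of k k'] single(3)[OF assms, of k'] by fastforce
  qed
  moreover have "(\<lambda>(k, j). (d k, j)) ` single_cells K F P s \<inter> (\<lambda>n. (n, main s)) ` filler_files K F N P d s = {}"
    by (auto simp: single_cells_eq[OF assms] filler_files_def)
  moreover have "finite (single_cells K F P s)" "finite (filler_files K F N P d s)"
    by (simp_all add: single_cells_eq[OF assms] finite_cols filler_files_def)
  ultimately show ?thesis
    unfolding payload_def cells_def
    using xor_Xor_union[of "\<lambda>(k, j). (d k, j)" "single_cells K F P s" "\<lambda>n. (n, main s)"
        "filler_files K F N P d s" l "\<lambda>(n, j). split_file F (W n) ! j"]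
    by (simp add: inj_on_def case_prod_unfold)
qed

lemma length_payload: "length (payload K F N l P W d s) = l"
  by (simp add: payload_def xor_def length_Xor)

text \<open>Packets for other members of the group lie in rows with \<open>*\<close> in column
  \<open>k\<close>, and fillers lie in the main row, so exactly one cell can be missing from the
  cache.\<close>

lemma cells_cached:
  assumes "s \<in> signals k" "(n, j) \<in> cells d s" "(n, j) \<noteq> (d k, single s k)"
  shows "j \<in> cached k"
proof -
  have s: "s < S" "k \<in> cols s" using assms(1) by (auto simp: signals_iff)
  from assms(2) consider k' where "k' \<in> cols s" "n = d k'" "j = single s k'" | "j = main s"
    by (auto simp: cells_eq[OF s(1)])
  then show ?thesis
  proof cases
    case 1
    with assms(3) have "k \<noteq> k'" by auto
    then show ?thesis using 1 s single_None[of s k' k] single(1)[of s k'] by (simp add: cached_def)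
  qed (use assms(1) in \<open>simp add: cached_def\<close>)
qed

lemma own_cell: "s \<in> signals k \<Longrightarrow> (d k, single s k) \<in> cells d s"
  by (auto simp: signals_iff cells_eq)

lemma cells_file_less: "s < S \<Longrightarrow> d \<in> demand_vectors K N \<Longrightarrow> (n, j) \<in> cells d s \<Longrightarrow> n < N"
  by (auto simp: cells_eq demand_vectors_def dest: cols_less PiE_mem)

lemma single_not_cached: "s \<in> signals k \<Longrightarrow> k < K \<Longrightarrow> single s k \<notin> cached k"
  using rows_partition(2) by blast

text \<open>By the row counts, a user without signals forces \<open>Z = F\<close>. As
  \<open>Z\<close> is common to all columns, no user would then have a signal, contradicting
  (C2).\<close>

lemma signals_nonempty:
  assumes "k < K" "0 < S"
  shows "signals k \<noteq> {}"
proof -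
  have "signals k = {} \<longleftrightarrow> Z = F" if "k < K" for k
    using card_cached[OF that] card_rows[OF that] finite_signals by (auto simp flip: card_0_eq)
  moreover have "\<exists>k'<K. signals k' \<noteq> {}"
  proof -
    have "4 \<le> card {(j, k). j < F \<and> k < K \<and> P j k = Some 0}" using spda assms(2) unfolding spda_def by blast
    then have "{(j, k). j < F \<and> k < K \<and> P j k = Some 0} \<noteq> {}" by (metis card.empty not_numeral_le_zero)
    then show ?thesis using assms(2) by (fastforce simp: signals_iff cols_of_def)
  qed
  ultimately show ?thesis using assms(1) by blast
qed

section \<open>Memory, rate and decoding\<close>

abbreviation L :: nat where "L \<equiv> B div F"

definition files_ok :: "(nat \<Rightarrow> bit list) \<Rightarrow> bool" where
  "files_ok W \<longleftrightarrow> (\<forall>n<N. W n \<in> bitstrings B)"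

definition labels_ok :: "(nat \<Rightarrow> nat \<Rightarrow> nat) \<Rightarrow> bool" where
  "labels_ok \<phi> \<longleftrightarrow> (\<forall>n<N. \<phi> n permutes {..<F})"

lemma labels_eq_iff: "labels_ok \<phi> \<Longrightarrow> n < N \<Longrightarrow> \<phi> n j = \<phi> n j' \<longleftrightarrow> j = j'"
  by (metis labels_ok_def permutes_inj injD)

lemma memory_eq:
  assumes "files_ok W" "labels_ok \<phi>" "k < K" "0 < N"
  shows "memory K F S N B P k (W, \<phi>, T, d) / real N = (real F + real Z) / (2 * real F)"
proof -
  let ?p = "\<lambda>(n, j). labelled_packet F W \<phi> n j"
  have cache: "cache K F S N P k W \<phi> = ?p ` ({..<N} \<times> cached k)"
    by (auto simp: cache_eq[OF assms(3)])
  \<comment> \<open>The cache is a set, so packets with equal contents count separately only because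
    their labels or file indices differ.\<close>
  have inj: "inj_on ?p ({..<N} \<times> cached k)"
    using labels_eq_iff[OF assms(2)] by (auto simp: inj_on_def labelled_packet_def)
  have "(\<Sum>(n, l, w)\<in>cache K F S N P k W \<phi>. length w) = (\<Sum>x\<in>{..<N} \<times> cached k. L)"
    unfolding cache sum.reindex[OF inj] using assms(1) cached_less
    by (intro sum.cong) (auto simp: labelled_packet_def length_nth_split_file files_ok_def bitstrings_def)
  also have "\<dots> = N * card (cached k) * L" by (simp add: card_cartesian_product)
  finally have *: "memory K F S N B P k (W, \<phi>, T, d) = real (N * card (cached k) * L) / real B"
    by (simp add: memory_def flip: of_nat_sum)
  have "real B = real F * real L" using F_dvd by (metis dvd_mult_div_cancel of_nat_mult)
  moreover have "real F + real Z = 2 * real (card (cached k))"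
    using card_cached[OF assms(3)] by (metis of_nat_add of_nat_mult of_nat_numeral)
  moreover have "0 < L" using F_dvd B_pos F_pos by (simp add: div_greater_zero_iff dvd_imp_le)
  ultimately show ?thesis unfolding * using assms(4) F_pos by (simp add: field_simps)
qed

lemma rate_eq:
  assumes "\<And>s. s < S \<Longrightarrow> length (T s) = L"
  shows "rate K F S N B P (W, \<phi>, T, d) = real S / real F"
proof -
  have "(\<Sum>s<S. length (snd (broadcast K F N L P W \<phi> T d s))) = S * L"
    using assms by (simp add: broadcast_def xor_def length_payload)
  moreover have "real B = real F * real L" using F_dvd by (metis dvd_mult_div_cancel of_nat_mult)
  moreover have "0 < L" using F_dvd B_pos F_pos by (simp add: div_greater_zero_iff dvd_imp_le)
  ultimately show ?thesis using F_pos by (simp add: rate_def flip: of_nat_sum)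
qed

lemma subpacketization:
  assumes "files_ok W"
  shows "has_subpacketization F N B F (W, \<phi>, T, d)"
  using assms F_dvd F_pos unfolding has_subpacketization_def files_ok_def bitstrings_def
  by (auto simp: concat_split_file length_split_file in_set_conv_nth length_nth_split_file real_of_nat_div)

text \<open>Equal caches list the same labels and contents, but a label may sit at another position
  in the second outcome; hence the new position \<open>j'\<close>.\<close>

lemma cached_packet_transfer:
  assumes "k < K" "cache K F S N P k W \<phi> = cache K F S N P k W' \<phi>'" "n < N" "j \<in> cached k"
  obtains j' where "j' \<in> cached k" "\<phi>' n j' = \<phi> n j" "split_file F (W' n) ! j' = split_file F (W n) ! j"
proof -
  have "labelled_packet F W \<phi> n j \<in> cache K F S N P k W \<phi>"
    using assms(3,4) unfolding cache_eq[OF assms(1)] by blast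
  then have "labelled_packet F W \<phi> n j \<in> cache K F S N P k W' \<phi>'" unfolding assms(2) .
  then show thesis using that by (auto simp: cache_eq[OF assms(1)] labelled_packet_def)
qed

text \<open>The packet that user \<open>k\<close> lacks is the only one in the header that its cache does not list,
  so its file index is \<open>d k\<close>.\<close>

lemma demand_determined:
  assumes "k < K" "s \<in> signals k" "d \<in> demand_vectors K N" "d' \<in> demand_vectors K N" "labels_ok \<phi>"
    and cache: "cache K F S N P k W \<phi> = cache K F S N P k W' \<phi>'"
    and header: "header K F N P \<phi> d s = header K F N P \<phi>' d' s"
  shows "d k = d' k"
proof (rule ccontr)
  assume neq: "d k \<noteq> d' k"
  have s: "s < S" using assms(2) by (simp add: signals_iff)
  have "(d k, \<phi> (d k) (single s k)) \<in> (\<lambda>(n, j). (n, \<phi>' n j)) ` cells d' s"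
    using own_cell[OF assms(2), of d] header by (force simp: header_eq)
  then obtain j where j: "(d k, j) \<in> cells d' s" "\<phi> (d k) (single s k) = \<phi>' (d k) j" by auto
  then have "j \<in> cached k" using cells_cached[OF assms(2)] neq by blast
  moreover have dk: "d k < N" using cells_file_less[OF s assms(4) j(1)] .
  ultimately obtain j' where "j' \<in> cached k" "\<phi> (d k) j' = \<phi>' (d k) j"
    using cached_packet_transfer[OF assms(1) cache[symmetric]] by metis
  then have "single s k \<in> cached k"
    using j(2) labels_eq_iff[OF assms(5) dk] by metis
  then show False using single_not_cached[OF assms(2,1)] by blast
qed

definition labelled_content :: "(nat \<Rightarrow> bit list) \<Rightarrow> (nat \<Rightarrow> nat \<Rightarrow> nat) \<Rightarrow> nat \<times> nat \<Rightarrow> bit list" where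
  "labelled_content W \<phi> = (\<lambda>(n, l). split_file F (W n) ! inv (\<phi> n) l)"

lemma labelled_content_label:
  "labels_ok \<phi> \<Longrightarrow> n < N \<Longrightarrow> labelled_content W \<phi> (n, \<phi> n j) = split_file F (W n) ! j"
  by (simp add: labelled_content_def labels_ok_def permutes_inverses(2)[of _ "{..<F}"])

text \<open>Indexing contents by label, as \<open>labelled_content\<close> does, makes the payload a
  sum over the header. Outcomes with the same header are then summed over the same index set,
  whatever their positions are.\<close>

lemma payload_header:
  assumes "s < S" "d \<in> demand_vectors K N" "labels_ok \<phi>"
  shows "payload K F N l P W d s = Xor l (labelled_content W \<phi>) (snd (header K F N P \<phi> d s))"
proof -
  have "inj_on (\<lambda>(n, j). (n, \<phi> n j)) (cells d s)"
    using cells_file_less[OF assms(1,2)] labels_eq_iff[OF assms(3)] by (auto simp: inj_on_def)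
  then show ?thesis
    unfolding payload_eq[OF assms(1)] header_eq snd_conv Xor_def
    using cells_file_less[OF assms(1,2)]
    by (auto simp: sum.reindex labelled_content_label[OF assms(3)] intro!: sum.cong)
qed

text \<open>Both payloads are sums over one header. All entries but \<open>?x\<close> are cached and
  agree in the two outcomes; cancelling them leaves the contents at \<open>?x\<close>.\<close>

lemma packet_determined:
  assumes "k < K" "s \<in> signals k" "d \<in> demand_vectors K N" "d' \<in> demand_vectors K N"
    and ok: "files_ok W" "files_ok W'" "labels_ok \<phi>" "labels_ok \<phi>'"
    and cache: "cache K F S N P k W \<phi> = cache K F S N P k W' \<phi>'"
    and header: "header K F N P \<phi> d s = header K F N P \<phi>' d' s"
    and payload: "payload K F N L P W d s = payload K F N L P W' d' s"
    and demand: "d k = d' k" "\<phi> (d k) = \<phi>' (d k)"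
  shows "split_file F (W (d k)) ! single s k = split_file F (W' (d k)) ! single s k"
proof -
  let ?H = "snd (header K F N P \<phi> d s)" and ?x = "(d k, \<phi> (d k) (single s k))"
  have s: "s < S" using assms(2) by (simp add: signals_iff)
  have x: "?x \<in> ?H" using own_cell[OF assms(2), of d] by (force simp: header_eq)
  have fin: "finite ?H" by (simp add: header_eq finite_cells[OF s])
  have dk: "d k < N" using cells_file_less[OF s assms(3) own_cell[OF assms(2)]] .
  have others: "labelled_content W \<phi> y = labelled_content W' \<phi>' y" if "y \<in> ?H" "y \<noteq> ?x" for y
  proof -
    from that(1) obtain n j where y: "(n, j) \<in> cells d s" "y = (n, \<phi> n j)" by (auto simp: header_eq)
    have n: "n < N" using cells_file_less[OF s assms(3) y(1)] .
    have "j \<in> cached k" using cells_cached[OF assms(2) y(1)] y(2) that(2) by blast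
    then obtain j' where "\<phi>' n j' = \<phi> n j" "split_file F (W' n) ! j' = split_file F (W n) ! j"
      using cached_packet_transfer[OF assms(1) cache n] by metis
    then show ?thesis unfolding y(2) using labelled_content_label[OF _ n] ok(3,4) by metis
  qed
  have packet: "labelled_content W \<phi> ?x = split_file F (W (d k)) ! single s k"
      "labelled_content W' \<phi>' ?x = split_file F (W' (d k)) ! single s k"
    using labelled_content_label[OF ok(3) dk] labelled_content_label[OF ok(4) dk] demand(2) by simp_all
  have less: "single s k < F" using single(1) assms(2) by (simp add: signals_iff)
  show ?thesis
  proof (rule nth_equalityI)
    show "length (split_file F (W (d k)) ! single s k) = length (split_file F (W' (d k)) ! single s k)"
      using ok(1,2) dk by (simp add: length_nth_split_file[OF less] files_ok_def bitstrings_def)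
    fix i assume "i < length (split_file F (W (d k)) ! single s k)"
    then have i: "i < L" using ok(1) dk by (simp add: length_nth_split_file[OF less] files_ok_def bitstrings_def)
    have "(\<Sum>y\<in>?H. labelled_content W \<phi> y ! i) = (\<Sum>y\<in>?H. labelled_content W' \<phi>' y ! i)"
      using arg_cong[OF payload, of "\<lambda>w. w ! i"] i
      unfolding payload_header[OF s assms(3) ok(3)] payload_header[OF s assms(4) ok(4)] header[symmetric]
      by (simp add: Xor_def)
    moreover have "(\<Sum>y\<in>?H - {?x}. labelled_content W \<phi> y ! i) = (\<Sum>y\<in>?H - {?x}. labelled_content W' \<phi>' y ! i)"
      using others by (intro sum.cong) auto
    ultimately have "labelled_content W \<phi> ?x ! i = labelled_content W' \<phi>' ?x ! i"
      unfolding sum.remove[OF fin x] by (metis add_right_cancel)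
    then show "split_file F (W (d k)) ! single s k ! i = split_file F (W' (d k)) ! single s k ! i"
      by (simp only: packet)
  qed
qed

text \<open>Common keys cancel the masks, a header reveals \<open>d k\<close>, and cached and
  decoded packets together cover all positions. The assumption \<open>demand\<close> supplies
  \<open>d k\<close> when no header reaches user \<open>k\<close>.\<close>

lemma file_determined:
  assumes "k < K" "d \<in> demand_vectors K N" "d' \<in> demand_vectors K N"
    and ok: "files_ok W" "files_ok W'" "labels_ok \<phi>" "labels_ok \<phi>'"
    and keys: "\<And>s. s < S \<Longrightarrow> length (T s) = L" "\<And>s. s < S \<Longrightarrow> length (T' s) = L"
    and input: "decoder_input K F S N B P k (W, \<phi>, T, d) = decoder_input K F S N B P k (W', \<phi>', T', d')"
    and demand: "signals k = {} \<Longrightarrow> d k = d' k"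
  shows "W (d k) = W' (d' k)"
proof -
  have cache: "cache K F S N P k W \<phi> = cache K F S N P k W' \<phi>'" and \<phi>: "\<phi> (d k) = \<phi>' (d' k)"
    using input by (simp_all add: decoder_input_def)
  have "restrict T (signals k) = restrict T' (signals k)"
    "restrict (broadcast K F N L P W \<phi> T d) (signals k) = restrict (broadcast K F N L P W' \<phi>' T' d') (signals k)"
    using input by (simp_all add: decoder_input_def key_cache_def)
  then have key: "T s = T' s"
    and bc: "broadcast K F N L P W \<phi> T d s = broadcast K F N L P W' \<phi>' T' d' s" if "s \<in> signals k" for s
    using that by (metis restrict_apply')+
  have header: "header K F N P \<phi> d s = header K F N P \<phi>' d' s"
    and masked: "xor (T s) (payload K F N L P W d s) = xor (T s) (payload K F N L P W' d' s)" if "s \<in> signals k" for s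
    using bc[OF that] key[OF that] by (simp_all add: broadcast_def)
  have payload: "payload K F N L P W d s = payload K F N L P W' d' s" if "s \<in> signals k" for s
    by (rule xor_left_cancel[OF _ _ masked[OF that]]) (use that keys(1) in \<open>simp_all add: length_payload signals_iff\<close>)
  have dk: "d k = d' k"
    using demand demand_determined[OF assms(1) _ assms(2,3) ok(3) cache header] by blast
  have n: "d k < N" using assms(1,2) by (auto simp: demand_vectors_def)
  have "split_file F (W (d k)) ! j = split_file F (W' (d k)) ! j" if "j < F" for j
  proof -
    from that have "j \<in> cached k \<union> (\<lambda>s. single s k) ` signals k"
      unfolding rows_partition(1)[OF assms(1), symmetric] by simp
    then consider "j \<in> cached k" | s where "s \<in> signals k" "j = single s k" by blast
    then show ?thesis
    proof cases
      case 1
      then obtain j' where "\<phi>' (d k) j' = \<phi> (d k) j" "split_file F (W' (d k)) ! j' = split_file F (W (d k)) ! j"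
        using cached_packet_transfer[OF assms(1) cache n] by metis
      \<comment> \<open>The privately sent permutation turns equal labels into equal
        positions.\<close>
      moreover from this have "j' = j" using \<phi> dk labels_eq_iff[OF ok(4) n] by metis
      ultimately show ?thesis by simp
    next
      case 2
      then show ?thesis
        using packet_determined[OF assms(1) _ assms(2,3) ok cache header payload dk] \<phi> dk by simp
    qed
  qed
  then have "split_file F (W (d k)) = split_file F (W' (d k))"
    by (intro nth_equalityI) (auto simp: length_split_file)
  then have "concat (split_file F (W (d k))) = concat (split_file F (W' (d k)))" by simp
  then show ?thesis
    using ok(1,2) n F_dvd dk by (simp add: concat_split_file files_ok_def bitstrings_def)
qed

section \<open>Decoding in the random system\<close>

lemma system_supportD:
  assumes "(W, \<phi>, T, d) \<in> set_pmf (system_pmf F S N B D)"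
  shows "files_ok W" "labels_ok \<phi>" "\<And>s. s < S \<Longrightarrow> length (T s) = L" "d \<in> set_pmf D"
proof -
  have "W \<in> PiE_dflt {..<N} [] (\<lambda>_. bitstrings B)" "\<phi> \<in> PiE_dflt {..<N} id (\<lambda>_. {\<pi>. \<pi> permutes {..<F}})"
      "T \<in> PiE_dflt {..<S} [] (\<lambda>_. bitstrings L)" "d \<in> set_pmf D"
    using assms by (simp_all add: system_pmf_def set_pmf_components)
  then show "files_ok W" "labels_ok \<phi>" "\<And>s. s < S \<Longrightarrow> length (T s) = L" "d \<in> set_pmf D"
    by (simp_all add: PiE_dflt_def files_ok_def labels_ok_def bitstrings_def)
qed

text \<open>If \<open>0 < S\<close>, every user receives a header that reveals its own demand. The
  second form adds the demand to the input and so also covers an array without symbols.\<close>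

lemma decodable:
  assumes "k < K" "set_pmf D \<subseteq> demand_vectors K N"
  shows "0 < S \<Longrightarrow> cond_entropy (system F S N B D) (requested_file k) (decoder_input K F S N B P k) = 0"
    and "cond_entropy (system F S N B D) (requested_file k)
      (\<lambda>\<omega>. (decoder_input K F S N B P k \<omega>, demand k \<omega>)) = 0"
proof -
  let ?p = "system_pmf F S N B D"
  have fin: "finite (set_pmf ?p)"
    using finite_set_system_pmf finite_subset[OF assms(2) finite_demand_vectors] by blast
  have det: "requested_file k \<omega> = requested_file k \<omega>'"
    if \<omega>: "\<omega> \<in> set_pmf ?p" "\<omega>' \<in> set_pmf ?p"
      and input: "decoder_input K F S N B P k \<omega> = decoder_input K F S N B P k \<omega>'"
      and demand: "signals k = {} \<Longrightarrow> demand k \<omega> = demand k \<omega>'" for \<omega> \<omega>'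
  proof -
    obtain W \<phi> T d where 1: "\<omega> = (W, \<phi>, T, d)" by (cases \<omega>)
    obtain W' \<phi>' T' d' where 2: "\<omega>' = (W', \<phi>', T', d')" by (cases \<omega>')
    note s1 = system_supportD[OF \<omega>(1)[unfolded 1]] and s2 = system_supportD[OF \<omega>(2)[unfolded 2]]
    have "W (d k) = W' (d' k)"
      using file_determined[OF assms(1) _ _ s1(1) s2(1) s1(2) s2(2) s1(3) s2(3) input[unfolded 1 2]]
        s1(4) s2(4) assms(2) demand unfolding 1 2 demand_def by auto
    then show ?thesis by (simp add: 1 2 requested_file_def)
  qed
  show "cond_entropy (system F S N B D) (requested_file k) (decoder_input K F S N B P k) = 0" if "0 < S"
    unfolding system_def
    by (rule cond_entropy_determined[OF fin], rule det) (use signals_nonempty[OF assms(1) that] in auto)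
  show "cond_entropy (system F S N B D) (requested_file k)
      (\<lambda>\<omega>. (decoder_input K F S N B P k \<omega>, demand k \<omega>)) = 0"
    unfolding system_def
    by (rule cond_entropy_determined[OF fin], rule det) auto
qed

section \<open>Private demands\<close>

text \<open>For distinct demands, the position of the one packet of file \<open>n\<close> in signal
  \<open>s\<close>; \<open>inv_into\<close> then picks the only member of the group that requests
  \<open>n\<close>.\<close>

definition row :: "(nat \<Rightarrow> nat) \<Rightarrow> nat \<Rightarrow> nat \<Rightarrow> nat" where
  "row d s n = (if n \<in> d ` cols s then single s (inv_into (cols s) d n) else main s)"

lemma inj_on_cols: "inj_on d {..<K} \<Longrightarrow> inj_on d (cols s)"
  by (rule inj_on_subset) (auto dest: cols_less)

lemma row_requested: "inj_on d {..<K} \<Longrightarrow> k \<in> cols s \<Longrightarrow> row d s (d k) = single s k"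
  by (simp add: row_def inj_on_cols)

lemma row_cases:
  assumes "inj_on d {..<K}"
  obtains k where "k \<in> cols s" "n = d k" "row d s n = single s k" | "n \<notin> d ` cols s" "row d s n = main s"
  using row_requested[OF assms] by (cases "n \<in> d ` cols s") (auto simp: row_def)

lemma cells_row:
  assumes "s < S" "d \<in> demand_vectors K N" "inj_on d {..<K}"
  shows "cells d s = (\<lambda>n. (n, row d s n)) ` {..<N}"
proof -
  have "d ` cols s \<subseteq> {..<N}"
    using assms(2) by (auto simp: demand_vectors_def dest: cols_less)
  then have split: "d ` cols s \<union> ({..<N} - d ` cols s) = {..<N}" by blast
  have requested: "(\<lambda>k. (d k, single s k)) ` cols s = (\<lambda>n. (n, row d s n)) ` d ` cols s"
    using row_requested[OF assms(3)] by (simp add: image_image)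
  have filler: "(\<lambda>n. (n, main s)) ` ({..<N} - d ` cols s) = (\<lambda>n. (n, row d s n)) ` ({..<N} - d ` cols s)"
    by (intro image_cong) (auto simp: row_def)
  show ?thesis
    unfolding cells_eq[OF assms(1)] requested filler image_Un[symmetric] split ..
qed

text \<open>Leaving the row choice \<open>\<rho>\<close> free allows the true signal, with
  \<open>row d\<close>, to be compared with one that ignores the other demands, with
  \<open>requested_row\<close>.\<close>

definition row_signal ::
  "(nat \<Rightarrow> nat \<Rightarrow> nat) \<Rightarrow> (nat \<Rightarrow> bit list) \<Rightarrow> (nat \<Rightarrow> nat \<Rightarrow> nat) \<Rightarrow> nat \<Rightarrow>
    (nat set \<times> (nat \<times> nat) set) \<times> bit list" where
  "row_signal \<rho> W \<phi> s = ((cols s, (\<lambda>n. (n, \<phi> n (\<rho> s n))) ` {..<N}),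
     Xor L (\<lambda>n. split_file F (W n) ! \<rho> s n) {..<N})"

lemma signal_eq_row_signal:
  assumes "s < S" "d \<in> demand_vectors K N" "inj_on d {..<K}"
  shows "signal K F N L P W \<phi> d s = row_signal (row d) W \<phi> s"
  unfolding signal_def header_eq payload_eq[OF assms(1)] cells_row[OF assms]
  by (simp add: row_signal_def image_image Xor_def sum.reindex inj_on_def)

text \<open>The file \<open>d k\<close> stays fixed because user \<open>k\<close> knows its
  permutation. Symbols whose row is already the main row are left out so that the exchanged images
  are disjoint.\<close>

definition swap_rows :: "nat \<Rightarrow> (nat \<Rightarrow> nat) \<Rightarrow> nat \<Rightarrow> nat \<Rightarrow> nat" where
  "swap_rows k d n =
    (if n = d k then id else exchange main (\<lambda>s. row d s n) {s \<in> signals k. row d s n \<noteq> main s})"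

text \<open>A moved row belongs to another requester \<open>k'\<close> of file \<open>n\<close> and
  has \<open>*\<close> in column \<open>k\<close>; so it is cached and differs from all main rows of
  user \<open>k\<close>. As demands are distinct, \<open>k'\<close> is the same for all
  \<open>s\<close>, and equal rows carry equal symbols in column \<open>k'\<close>.\<close>

lemma moved_rows:
  assumes "inj_on d {..<K}" "n \<noteq> d k"
  defines "A \<equiv> {s \<in> signals k. row d s n \<noteq> main s}"
  shows "inj_on main A" "inj_on (\<lambda>s. row d s n) A" "main ` A \<inter> (\<lambda>s. row d s n) ` A = {}"
    "main ` A \<subseteq> cached k" "(\<lambda>s. row d s n) ` A \<subseteq> cached k"
proof -
  have A: "s < S \<and> k \<in> cols s \<and> P (row d s n) k = None \<and> row d s n < F \<and>
      (\<exists>k'. k' < K \<and> n = d k' \<and> P (row d s n) k' = Some s)" if "s \<in> A" for s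
  proof -
    have s: "s < S" "k \<in> cols s" "row d s n \<noteq> main s" using that by (auto simp: A_def signals_iff)
    obtain k' where k': "k' \<in> cols s" "n = d k'" "row d s n = single s k'"
      using row_cases[OF assms(1), of s n] s(3) by metis
    then have "k \<noteq> k'" using assms(2) by auto
    then show ?thesis using s k' single_None[of s k' k] single[of s k'] cols_less by auto
  qed
  show "inj_on main A" by (rule inj_on_subset[OF inj_on_main]) (auto simp: A_def)
  show "inj_on (\<lambda>s. row d s n) A"
  proof (rule inj_onI)
    fix s s' assume "s \<in> A" "s' \<in> A" and eq: "row d s n = row d s' n"
    then obtain k1 k2 where k1: "k1 < K" "n = d k1" "P (row d s n) k1 = Some s"
      and k2: "k2 < K" "n = d k2" "P (row d s n) k2 = Some s'" using A eq by metis
    have "k1 = k2" using inj_onD[OF assms(1), of k1 k2] k1(1,2) k2(1,2) by simp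
    then show "s = s'" using k1(3) k2(3) by simp
  qed
  show "main ` A \<inter> (\<lambda>s. row d s n) ` A = {}"
  proof -
    have "main s \<noteq> row d s' n" if "s \<in> A" "s' \<in> A" for s s'
      using A[OF that(1)] A[OF that(2)] main_eq[of s k] by auto
    then show ?thesis by blast
  qed
  show "main ` A \<subseteq> cached k" by (auto simp: A_def cached_def)
  show "(\<lambda>s. row d s n) ` A \<subseteq> cached k" using A by (auto simp: cached_def)
qed

lemma swap_rows:
  assumes "inj_on d {..<K}"
  shows swap_rows_involution: "swap_rows k d n (swap_rows k d n j) = j"
    and swap_rows_cached: "j \<in> cached k \<Longrightarrow> swap_rows k d n j \<in> cached k"
    and swap_rows_less: "j < F \<Longrightarrow> swap_rows k d n j < F"
    and swap_rows_main: "n \<noteq> d k \<Longrightarrow> s \<in> signals k \<Longrightarrow> swap_rows k d n (main s) = row d s n"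
proof -
  show "swap_rows k d n (swap_rows k d n j) = j"
    using exchange_involution[OF moved_rows(1-3)[OF assms]] by (simp add: swap_rows_def)
  show "swap_rows k d n j \<in> cached k" if "j \<in> cached k"
    using exchange_mem[OF moved_rows[OF assms]] that by (simp add: swap_rows_def)
  have cached_F: "cached k \<subseteq> {..<F}" using cached_less by blast
  show "swap_rows k d n j < F" if "j < F"
  proof (cases "n = d k")
    case False
    note m = moved_rows[OF assms False]
    show ?thesis
      using exchange_mem[OF m(1-3) order_trans[OF m(4) cached_F] order_trans[OF m(5) cached_F]] that False
      by (simp add: swap_rows_def)
  qed (use that in \<open>simp add: swap_rows_def\<close>)
  show "swap_rows k d n (main s) = row d s n" if "n \<noteq> d k" "s \<in> signals k"
  proof (cases "row d s n = main s")
    case True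
    have "main s \<notin> main ` {s \<in> signals k. row d s n \<noteq> main s}"
      using True inj_on_main that(2) by (auto dest: inj_onD)
    \<comment> \<open>Another symbol cannot move \<open>main s\<close> either, since its row would
      have \<open>*\<close> in column \<open>k\<close>.\<close>
    moreover have "main s \<notin> (\<lambda>s. row d s n) ` {s \<in> signals k. row d s n \<noteq> main s}"
    proof
      assume "main s \<in> (\<lambda>s. row d s n) ` {s \<in> signals k. row d s n \<noteq> main s}"
      then obtain s' where s': "s' \<in> signals k" "row d s' n \<noteq> main s'" "main s = row d s' n" by auto
      then obtain k' where k': "k' \<in> cols s'" "n = d k'" "row d s' n = single s' k'"
        using row_cases[OF assms, of s' n] by metis
      then have "P (main s) k = None"
        using single_None[of s' k' k] s'(1,3) that(1) by (auto simp: signals_iff)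
      then show False using main_eq that(2) by (simp add: signals_iff)
    qed
    ultimately show ?thesis using that(1) True by (simp add: swap_rows_def exchange_other)
  next
    case False
    then show ?thesis using that exchange_left[OF moved_rows(1)[OF assms that(1)]] by (simp add: swap_rows_def)
  qed
qed

lemma swap_rows_permutes:
  assumes "inj_on d {..<K}"
  shows "swap_rows k d n permutes {..<F}"
proof -
  have "swap_rows k d n j = j" if "j \<notin> {..<F}" for j
  proof (cases "n = d k")
    case False
    then show ?thesis
      using moved_rows(4,5)[OF assms False] that cached_less
      by (auto simp: swap_rows_def intro!: exchange_other)
  qed (simp add: swap_rows_def)
  then show ?thesis
    unfolding permutes_def using swap_rows_involution[OF assms] by metis
qed

text \<open>Contents and labels move by the same involution of positions, so each labelled packet
  survives intact and only changes its position; the keys are untouched.\<close>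

definition shuffle :: "nat \<Rightarrow> (nat \<Rightarrow> nat) \<Rightarrow>
    (nat \<Rightarrow> bit list) \<times> (nat \<Rightarrow> nat \<Rightarrow> nat) \<times> (nat \<Rightarrow> bit list) \<Rightarrow>
    (nat \<Rightarrow> bit list) \<times> (nat \<Rightarrow> nat \<Rightarrow> nat) \<times> (nat \<Rightarrow> bit list)" where
  "shuffle k d = (\<lambda>(W, \<phi>, T).
    (\<lambda>n. if n \<in> {..<N} then permute_file F (swap_rows k d n) (W n) else [],
     \<lambda>n. if n \<in> {..<N} then \<phi> n \<circ> swap_rows k d n else id, T))"

lemma shuffle_invariant:
  assumes "inj_on d {..<K}"
  shows "map_pmf (shuffle k d)
    (pair_pmf (Pi_pmf {..<N} [] (\<lambda>_. pmf_of_set (bitstrings B)))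
      (pair_pmf (Pi_pmf {..<N} id (\<lambda>_. pmf_of_set {\<pi>. \<pi> permutes {..<F}})) Q)) =
    pair_pmf (Pi_pmf {..<N} [] (\<lambda>_. pmf_of_set (bitstrings B)))
      (pair_pmf (Pi_pmf {..<N} id (\<lambda>_. pmf_of_set {\<pi>. \<pi> permutes {..<F}})) Q)"
proof -
  let ?f = "\<lambda>W n. if n \<in> {..<N} then permute_file F (swap_rows k d n) (W n) else []"
  let ?g = "\<lambda>\<phi> n. if n \<in> {..<N} then \<phi> n \<circ> swap_rows k d n else id"
  have involution: "permute_file F (swap_rows k d n) (permute_file F (swap_rows k d n) w) = w"
    if "w \<in> bitstrings B" for n w
    using that F_dvd
    by (intro permute_file_involution) (simp_all add: swap_rows_less swap_rows_involution assms bitstrings_def)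
  have "shuffle k d = (\<lambda>(W, x). (?f W, (\<lambda>(\<phi>, T). (?g \<phi>, T)) x))"
    by (auto simp: shuffle_def fun_eq_iff)
  moreover have "map_pmf ?f (Pi_pmf {..<N} [] (\<lambda>_. pmf_of_set (bitstrings B))) =
      Pi_pmf {..<N} [] (\<lambda>_. pmf_of_set (bitstrings B))"
    by (rule map_pmf_Pi_pmf_involution)
      (use F_dvd in \<open>auto simp: finite_bitstrings bitstrings_nonempty permute_file_bitstrings
         swap_rows_less[OF assms] involution\<close>)
  moreover have "map_pmf ?g (Pi_pmf {..<N} id (\<lambda>_. pmf_of_set {\<pi>. \<pi> permutes {..<F}})) =
      Pi_pmf {..<N} id (\<lambda>_. pmf_of_set {\<pi>. \<pi> permutes {..<F}})"
    by (rule map_pmf_Pi_pmf_involution[where f="\<lambda>n \<pi>. \<pi> \<circ> swap_rows k d n"])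
      (auto simp: finite_label_permutations permutes_compose swap_rows_permutes[OF assms]
         swap_rows_involution[OF assms] fun_eq_iff simp del: Collect_empty_eq)
  ultimately show ?thesis
    by (simp only: map_pair) (simp add: pair_map_pmf1[symmetric] apfst_def map_prod_def map_pair[where g="\<lambda>x. x", simplified])
qed

text \<open>Cached triples do not record positions, and the involution maps cached positions to
  cached positions.\<close>

lemma cache_shuffle:
  assumes "k < K" "inj_on d {..<K}" "shuffle k d (W, \<phi>, T) = (W', \<phi>', T')"
  shows "cache K F S N P k W' \<phi>' = cache K F S N P k W \<phi>"
proof -
  have packet: "labelled_packet F W' \<phi>' n j = labelled_packet F W \<phi> n (swap_rows k d n j)" if "n < N" "j < F" for n j
    using assms(3) that swap_rows_less[OF assms(2)] by (auto simp: shuffle_def labelled_packet_def split_permute_file)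
  have "{labelled_packet F W' \<phi>' n j | n j. n < N \<and> j \<in> cached k} = {labelled_packet F W \<phi> n j | n j. n < N \<and> j \<in> cached k}"
    using packet cached_less swap_rows_cached[OF assms(2)] swap_rows_involution[OF assms(2)]
    by auto metis+
  then show ?thesis by (simp add: cache_eq[OF assms(1)])
qed

text \<open>The rows of a signal in which only user \<open>k\<close> requests a file, with
  \<open>m\<close> standing for \<open>d k\<close>; no other demand enters.\<close>

definition requested_row :: "nat \<Rightarrow> nat \<Rightarrow> nat \<Rightarrow> nat \<Rightarrow> nat" where
  "requested_row k m s n = (if n = m then single s k else main s)"

text \<open>For \<open>n = d k\<close> both row choices are \<open>single s k\<close> and nothing
  moves; for every other file the involution sends \<open>main s\<close> to
  \<open>row d s n\<close>.\<close>

lemma row_signal_shuffle: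
  assumes "k < K" "inj_on d {..<K}" "shuffle k d (W, \<phi>, T) = (W', \<phi>', T')" "s \<in> signals k"
  shows "row_signal (requested_row k (d k)) W' \<phi>' s = row_signal (row d) W \<phi> s"
proof -
  have s: "s < S" "k \<in> cols s" using assms(4) by (auto simp: signals_iff)
  have swap: "swap_rows k d n (requested_row k (d k) s n) = row d s n" for n
    using swap_rows_main[OF assms(2) _ assms(4)] row_requested[OF assms(2) s(2)]
    by (auto simp: requested_row_def swap_rows_def)
  have less: "requested_row k (d k) s n < F" for n
    using s by (simp add: requested_row_def single(1) main_less)
  have "\<phi>' n (requested_row k (d k) s n) = \<phi> n (row d s n) \<and>
      split_file F (W' n) ! requested_row k (d k) s n = split_file F (W n) ! row d s n" if "n < N" for n
    using assms(3) that swap_rows_less[OF assms(2)] less[of n] swap[of n]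
    by (auto simp: shuffle_def split_permute_file)
  then show ?thesis by (simp add: row_signal_def Xor_def cong: image_cong_simp sum.cong_simp)
qed

lemma private_demands:
  assumes "k < K" "K \<le> N"
  shows "cond_mutual_info (system F S N B (distinct_demands K N)) (other_demands K k)
    (own_signals K F S N B P k) (side_information K F S N P k) = 0"
proof -
  let ?D = "distinct_demands K N"
  let ?Q = "pair_pmf (Pi_pmf {..<N} [] (\<lambda>_. pmf_of_set (bitstrings B)))
      (pair_pmf (Pi_pmf {..<N} id (\<lambda>_. pmf_of_set {\<pi>. \<pi> permutes {..<F}}))
        (Pi_pmf {..<S} [] (\<lambda>_. pmf_of_set (bitstrings L))))"
  have "finite {d \<in> demand_vectors K N. inj_on d {..<K}}"
    using finite_demand_vectors by simp
  \<comment> \<open>With \<open>K \<le> N\<close> the identity is an admissible demand vector, so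
    the uniform law has a nonempty set to live on.\<close>
  moreover have "restrict id {..<K} \<in> {d \<in> demand_vectors K N. inj_on d {..<K}}"
    using assms(2) by (auto simp: demand_vectors_def)
  ultimately have D: "set_pmf ?D = {d \<in> demand_vectors K N. inj_on d {..<K}}"
    unfolding distinct_demands_def by (intro set_pmf_of_set) auto
  let ?Y = "\<lambda>(W, \<phi>, T) m. restrict (row_signal (requested_row k m) W \<phi>) (signals k)"
  let ?Z = "\<lambda>(W, \<phi>, T) m. (\<phi> m, cache K F S N P k W \<phi>, m, groups K F S P k)"
  have less: "d k < N" if "d \<in> demand_vectors K N" for d
    using that assms(1) by (auto simp: demand_vectors_def)
  show ?thesis
    unfolding system_def system_pmf_eq
  \<comment> \<open>Here \<open>h d\<close> is \<open>d k\<close>: in terms of the shuffled data,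
    signals and side information retain nothing else of the demands, and \<open>?Z\<close> contains
    this value explicitly.\<close>
  proof (rule cond_mutual_info_zero_of_invariance[where \<theta>="shuffle k" and h="\<lambda>d. d k" and Y'="?Y" and Z'="?Z"
        and X'="\<lambda>d. restrict d ({..<K} - {k})"])
    show "finite (set_pmf ?Q)"
      by (auto simp: set_pmf_components finite_bitstrings finite_label_permutations
          intro!: finite_cartesian_product finite_PiE_dflt)
    show "finite (set_pmf ?D)" using D finite_demand_vectors by simp
    show "map_pmf (shuffle k d) ?Q = ?Q" if "d \<in> set_pmf ?D" for d
      using that D by (intro shuffle_invariant) auto
    fix q :: "(nat \<Rightarrow> bit list) \<times> (nat \<Rightarrow> nat \<Rightarrow> nat) \<times> (nat \<Rightarrow> bit list)" and d
    assume "d \<in> set_pmf ?D"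
    then have d: "d \<in> demand_vectors K N" "inj_on d {..<K}" by (auto simp: D)
    obtain W \<phi> T where q: "q = (W, \<phi>, T)" by (cases q)
    obtain W' \<phi>' T' where q': "shuffle k d (W, \<phi>, T) = (W', \<phi>', T')" by (cases "shuffle k d (W, \<phi>, T)")
    let ?\<omega> = "case (q, d) of (q, d) \<Rightarrow> (case q of (W, \<phi>, T) \<Rightarrow> \<lambda>d. (W, \<phi>, T, d)) d"
    show "other_demands K k ?\<omega> = restrict d ({..<K} - {k})"
      by (simp add: q other_demands_def)
    show "own_signals K F S N B P k ?\<omega> = ?Y (shuffle k d q) (d k)"
      unfolding q q' using row_signal_shuffle[OF assms(1) d(2) q'] signal_eq_row_signal[OF _ d]
      by (auto simp: own_signals_def signals_iff fun_eq_iff restrict_def)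
    have "\<phi>' (d k) = \<phi> (d k)"
      using q' less[OF d(1)] by (auto simp: shuffle_def swap_rows_def)
    then show "side_information K F S N P k ?\<omega> = ?Z (shuffle k d q) (d k)"
      unfolding q q' using cache_shuffle[OF assms(1) d(2) q'] by (simp add: side_information_def)
  qed (auto split: prod.splits)
qed

end

theorem theorem1:
  fixes K F Z S N B :: nat and P :: array
  assumes "spda K F Z S P"
    and "0 < N" and "0 < B" and "F dvd B"
  shows
    "(\<forall>D. set_pmf D \<subseteq> demand_vectors K N \<longrightarrow>
        (\<forall>\<omega>\<in>space (system F S N B D).
           (\<forall>k<K. memory K F S N B P k \<omega> / real N = (real F + real Z) / (2 * real F)) \<and>
           rate K F S N B P \<omega> = real S / real F \<and>
           has_subpacketization F N B F \<omega>) \<and>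
        (\<forall>k<K.
           (0 < S \<longrightarrow>
              cond_entropy (system F S N B D) (requested_file k)
                (decoder_input K F S N B P k) = 0) \<and>
           cond_entropy (system F S N B D) (requested_file k)
             (\<lambda>\<omega>. (decoder_input K F S N B P k \<omega>, demand k \<omega>)) = 0)) \<and>
     (K \<le> N \<longrightarrow>
        (\<forall>k<K.
           cond_mutual_info (system F S N B (distinct_demands K N))
             (other_demands K k)
             (own_signals K F S N B P k)
             (side_information K F S N P k) = 0))"
proof -
  interpret spda_scheme K F Z S N B P
    using assms by unfold_locales
  have "(\<forall>k<K. memory K F S N B P k \<omega> / real N = (real F + real Z) / (2 * real F)) \<and>
      rate K F S N B P \<omega> = real S / real F \<and> has_subpacketization F N B F \<omega>"
    if "\<omega> \<in> space (system F S N B D)" for \<omega> D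
  proof -
    obtain W \<phi> T d where \<omega>: "\<omega> = (W, \<phi>, T, d)" by (cases \<omega>)
    note supp = system_supportD[OF that[unfolded system_def space_support_space \<omega>]]
    show ?thesis
      unfolding \<omega>
      by (simp add: memory_eq[OF supp(1,2) _ assms(2)] rate_eq[of T] supp(3) subpacketization[OF supp(1)])
  qed
  then show ?thesis using decodable private_demands by blast
qed

end
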